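(* Let $k \ge 1$ be an integer and let $G$ be a $(k+1)$-connected graph of order $n$ that is fractional $k$-factor-critical, with minimum degree $\delta$, where $n \equiv k \pmod{2}$ and \[ n \ge \max\{8\delta-5k+20,~ \delta(\delta-k-1)^2 - 2\delta-1\}. \] If \[ \rho(G) \ge \rho(K_\delta \vee (K_{n-2\delta + k-3} \cup K_3 \cup (\delta-k)K_1)), \] then $G$ is $k$-factor-critical unless $G \cong K_\delta \vee (K_{n-2\delta + k-3} \cup K_3 \cup (\delta-k)K_1)$.
   Context: All graphs are finite, simple and undirected. $\rho(G)$ denotes the spectral radius (largest eigenvalue) of the adjacency matrix of $G$. $K_m$ is the complete graph on $m$ vertices; $G_1\cup G_2$ is the disjoint union; $G_1\vee G_2$ (join) is obtained from $G_1\cup G_2$ by adding all edges between $V(G_1)$ and $V(G_2)$; $aH$ denotes the disjoint union of $a$ copies of $H$. A graph of order $n$ is $t$-connected if $n>t$ and $G-X$ is connected for every $X\subseteq V(G)$ with $|X|<t$. A graph $G$ of order $n$ is $k$-factor-critical (for $0\le k<n$) if for every set of $k$ vertices, deleting them leaves a graph with a perfect matching. A fractional perfect matching of $G$ is a function $h:E(G)\to[0,1]$ with $\sum_{e\ni v} h(e)=1$ for every vertex $v$; $G$ is fractional $k$-factor-critical if deleting any $k$ vertices leaves a graph having a fractional perfect matching. *)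

theory Defs
  imports
    "HOL-Number_Theory.Cong"
    "Jordan_Normal_Form.Char_Poly"
begin

record 'a sgraph =
  verts :: "'a set"
  edges :: "'a set set"

definition simple_graph :: "'a sgraph \<Rightarrow> bool" where
  "simple_graph G \<longleftrightarrow>
     finite (verts G) \<and> (\<forall>e \<in> edges G. e \<subseteq> verts G \<and> card e = 2)"

definition graph_order :: "'a sgraph \<Rightarrow> nat" where
  "graph_order G = card (verts G)"

definition vertex_degree :: "'a sgraph \<Rightarrow> 'a \<Rightarrow> nat" where
  "vertex_degree G v = card {e \<in> edges G. v \<in> e}"

definition min_degree :: "'a sgraph \<Rightarrow> nat" where
  "min_degree G = Min (vertex_degree G ` verts G)"

definition delete_verts :: "'a sgraph \<Rightarrow> 'a set \<Rightarrow> 'a sgraph" where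
  "delete_verts G X = \<lparr>verts = verts G - X, edges = {e \<in> edges G. e \<inter> X = {}}\<rparr>"

definition graph_iso :: "'a sgraph \<Rightarrow> 'b sgraph \<Rightarrow> bool" where
  "graph_iso G H \<longleftrightarrow>
     (\<exists>f. bij_betw f (verts G) (verts H) \<and>
          (\<forall>u \<in> verts G. \<forall>v \<in> verts G. {u, v} \<in> edges G \<longleftrightarrow> {f u, f v} \<in> edges H))"

definition connected_graph :: "'a sgraph \<Rightarrow> bool" where
  "connected_graph G \<longleftrightarrow>
     verts G \<noteq> {} \<and>
     (\<forall>u \<in> verts G. \<forall>v \<in> verts G. (u, v) \<in> {(x, y). {x, y} \<in> edges G}\<^sup>*)"

definition t_connected :: "nat \<Rightarrow> 'a sgraph \<Rightarrow> bool" where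
  "t_connected t G \<longleftrightarrow>
     graph_order G > t \<and>
     (\<forall>X. X \<subseteq> verts G \<and> card X < t \<longrightarrow> connected_graph (delete_verts G X))"

definition perfect_matching :: "'a sgraph \<Rightarrow> 'a set set \<Rightarrow> bool" where
  "perfect_matching G M \<longleftrightarrow> M \<subseteq> edges G \<and> (\<forall>v \<in> verts G. \<exists>!e. e \<in> M \<and> v \<in> e)"

definition fractional_perfect_matching :: "'a sgraph \<Rightarrow> ('a set \<Rightarrow> real) \<Rightarrow> bool" where
  "fractional_perfect_matching G h \<longleftrightarrow>
     (\<forall>e \<in> edges G. h e \<in> {0..1}) \<and>
     (\<forall>v \<in> verts G. (\<Sum>e \<in> {e \<in> edges G. v \<in> e}. h e) = 1)"

definition factor_critical :: "nat \<Rightarrow> 'a sgraph \<Rightarrow> bool" where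
  "factor_critical k G \<longleftrightarrow>
     k < graph_order G \<and>
     (\<forall>X. X \<subseteq> verts G \<and> card X = k \<longrightarrow> (\<exists>M. perfect_matching (delete_verts G X) M))"

definition fractional_factor_critical :: "nat \<Rightarrow> 'a sgraph \<Rightarrow> bool" where
  "fractional_factor_critical k G \<longleftrightarrow>
     (\<forall>X. X \<subseteq> verts G \<and> card X = k \<longrightarrow>
        (\<exists>h. fractional_perfect_matching (delete_verts G X) h))"

definition complete_graph :: "nat \<Rightarrow> nat sgraph" where
  "complete_graph m =
     \<lparr>verts = {..<m}, edges = {{u, v} | u v. u < m \<and> v < m \<and> u \<noteq> v}\<rparr>"

definition disjoint_union :: "'a sgraph \<Rightarrow> 'b sgraph \<Rightarrow> ('a + 'b) sgraph" where
  "disjoint_union G H =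
     \<lparr>verts = verts G <+> verts H,
      edges = (`) Inl ` edges G \<union> (`) Inr ` edges H\<rparr>"

definition join :: "'a sgraph \<Rightarrow> 'b sgraph \<Rightarrow> ('a + 'b) sgraph" where
  "join G H =
     \<lparr>verts = verts (disjoint_union G H),
      edges = edges (disjoint_union G H) \<union> {{Inl u, Inr v} | u v. u \<in> verts G \<and> v \<in> verts H}\<rparr>"

definition copies :: "nat \<Rightarrow> 'a sgraph \<Rightarrow> (nat \<times> 'a) sgraph" where
  "copies a H =
     \<lparr>verts = {..<a} \<times> verts H,
      edges = (\<Union>i<a. (`) (Pair i) ` edges H)\<rparr>"

text \<open>The clique size \<open>n - 2\<delta> + k - 3\<close> is written with its additions first, so that truncated
  subtraction is harmless whenever \<open>2\<delta> + 3 \<le> n + k\<close>.\<close>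

definition extremal_graph ::
  "nat \<Rightarrow> nat \<Rightarrow> nat \<Rightarrow> (nat + (nat + nat) + nat \<times> nat) sgraph" where
  "extremal_graph n k \<delta> =
     join (complete_graph \<delta>)
       (disjoint_union
          (disjoint_union (complete_graph (n + k - 2 * \<delta> - 3)) (complete_graph 3))
          (copies (\<delta> - k) (complete_graph 1)))"

definition adj_matrix_wrt :: "'a list \<Rightarrow> 'a sgraph \<Rightarrow> real mat" where
  "adj_matrix_wrt vs G =
     mat (length vs) (length vs) (\<lambda>(i, j). if {vs ! i, vs ! j} \<in> edges G then 1 else 0)"

definition adj_matrix :: "'a sgraph \<Rightarrow> real mat" where
  "adj_matrix G = adj_matrix_wrt (SOME vs. distinct vs \<and> set vs = verts G) G"

text \<open>The adjacency matrix is real symmetric, so all its eigenvalues are real; by the lemmas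
  below they do not depend on the chosen enumeration of the vertices.\<close>

definition spectral_radius_graph :: "'a sgraph \<Rightarrow> real" where
  "spectral_radius_graph G = Max {\<theta>. eigenvalue (adj_matrix G) \<theta>}"

lemma eigenvalue_adj_matrix_wrt_iff:
  assumes vs: "distinct vs" "set vs = verts G"
  shows "eigenvalue (adj_matrix_wrt vs G) \<theta> \<longleftrightarrow>
    (\<exists>x. (\<exists>v \<in> verts G. x v \<noteq> 0) \<and>
         (\<forall>u \<in> verts G. (\<Sum>v \<in> verts G. (if {u, v} \<in> edges G then 1 else 0) * x v) = \<theta> * x u))"
    (is "?L \<longleftrightarrow> ?R")
proof -
  let ?n = "length vs" and ?A = "adj_matrix_wrt vs G"
  have bij: "bij_betw ((!) vs) {0..<?n} (verts G)"
    using vs bij_betw_nth[of vs "{0..<?n}" "verts G"] by (auto simp: atLeast0LessThan)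
  have V: "verts G = (!) vs ` {0..<?n}" using bij by (simp add: bij_betw_def)
  have inj: "inj_on ((!) vs) {0..<?n}" using bij by (simp add: bij_betw_def)
  have dim: "dim_row ?A = ?n" "dim_col ?A = ?n" by (simp_all add: adj_matrix_wrt_def)
  have prod: "(?A *\<^sub>v y) $ i =
      (\<Sum>j = 0..<?n. (if {vs ! i, vs ! j} \<in> edges G then 1 else 0) * y $ j)"
    if "i < ?n" "dim_vec y = ?n" for i y
    using that by (simp add: adj_matrix_wrt_def scalar_prod_def)
  show ?thesis
  proof
    assume ?L
    then obtain y where y: "dim_vec y = ?n" "y \<noteq> 0\<^sub>v ?n" "?A *\<^sub>v y = \<theta> \<cdot>\<^sub>v y"
      unfolding eigenvalue_def eigenvector_def dim by (metis carrier_vecD)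
    define x where "x v = y $ (the_inv_into {0..<?n} ((!) vs) v)" for v
    have x: "x (vs ! i) = y $ i" if "i < ?n" for i
      using that inj by (simp add: x_def the_inv_into_f_f)
    obtain i where i: "i < ?n" "y $ i \<noteq> 0"
    proof -
      have "\<exists>i < ?n. y $ i \<noteq> 0"
      proof (rule ccontr)
        assume "\<not> ?thesis"
        then have "y = 0\<^sub>v ?n" using y(1) by (intro eq_vecI) auto
        then show False using y(2) by simp
      qed
      then show ?thesis using that by blast
    qed
    show ?R
    proof (intro exI[of _ x] conjI ballI)
      show "\<exists>v\<in>verts G. x v \<noteq> 0" using i x V by auto
    next
      fix u assume "u \<in> verts G"
      then obtain j where j: "j < ?n" "u = vs ! j" using V by auto
      have "(\<Sum>v\<in>verts G. (if {u, v} \<in> edges G then 1 else 0) * x v) = (?A *\<^sub>v y) $ j"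
        unfolding V sum.reindex[OF inj] prod[OF j(1) y(1)] comp_def j(2)
        by (rule sum.cong) (auto simp: x)
      also have "\<dots> = \<theta> * x u" unfolding y(3) j(2) using j(1) y(1) by (simp add: x)
      finally show "(\<Sum>v\<in>verts G. (if {u, v} \<in> edges G then 1 else 0) * x v) = \<theta> * x u" .
    qed
  next
    assume ?R
    then obtain x where x: "\<exists>v\<in>verts G. x v \<noteq> 0"
      "\<And>u. u \<in> verts G \<Longrightarrow>
         (\<Sum>v\<in>verts G. (if {u, v} \<in> edges G then 1 else 0) * x v) = \<theta> * x u" by blast
    define y where "y = vec ?n (\<lambda>i. x (vs ! i))"
    have "y \<noteq> 0\<^sub>v ?n"
    proof
      assume 0: "y = 0\<^sub>v ?n"
      have "x (vs ! i) = 0" if "i < ?n" for i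
        using arg_cong[OF 0, of "\<lambda>w. w $ i"] that by (simp add: y_def)
      then show False using x(1) V by auto
    qed
    moreover have "?A *\<^sub>v y = \<theta> \<cdot>\<^sub>v y"
    proof (rule eq_vecI)
      fix i assume "i < dim_vec (\<theta> \<cdot>\<^sub>v y)"
      then have i: "i < ?n" by (simp add: y_def)
      then have "vs ! i \<in> verts G" using V by auto
      from x(2)[OF this] show "(?A *\<^sub>v y) $ i = (\<theta> \<cdot>\<^sub>v y) $ i"
        unfolding V sum.reindex[OF inj] comp_def using i
        by (subst prod) (simp_all add: y_def)
    qed (simp add: dim y_def)
    moreover have "y \<in> carrier_vec ?n" by (simp add: y_def)
    ultimately have "eigenvector ?A y \<theta>" by (simp add: eigenvector_def dim)
    then show ?L unfolding eigenvalue_def by blast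
  qed
qed

lemma eigenvalue_adj_matrix_eq:
  assumes "distinct vs" "set vs = verts G"
  shows "eigenvalue (adj_matrix G) \<theta> \<longleftrightarrow> eigenvalue (adj_matrix_wrt vs G) \<theta>"
proof -
  have "\<exists>ws. distinct ws \<and> set ws = verts G" using assms by blast
  from someI_ex[OF this] show ?thesis
    unfolding adj_matrix_def using assms by (simp add: eigenvalue_adj_matrix_wrt_iff)
qed

end

theory Submission
  imports Defs "Jordan_Normal_Form.Spectral_Radius"
begin

text \<open>If \<open>G\<close> is not \<open>k\<close>-factor-critical, Tutte's theorem and parity give a set \<open>S\<close> of \<open>s\<close> vertices and at
  least \<open>s - k + 2\<close> odd unions of components of \<open>G - S\<close>; connectivity forces \<open>s > k\<close>, and fractional
  criticality allows at most \<open>s - k\<close> of them to be singletons. Merging the surplus gives a partition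
  \<open>\<Q>\<close> of \<open>V - S\<close> into \<open>s - k + 2\<close> parts without edges between them. Let \<open>\<theta>\<close> be the eigenvalue of the
  extremal graph with a positive eigenvector. The vector that is \<open>1\<close> on \<open>S\<close> and \<open>s / (\<theta> + 1 - |Q|)\<close> on
  \<open>Q\<close> shows by a Collatz--Wielandt argument that \<open>\<rho>(G) < \<theta>\<close> as soon as
  \<open>s - 1 + s \<Sum>\<^sub>Q |Q| / (\<theta> + 1 - |Q|) < \<theta>\<close>, and that equality forces all edges inside \<open>S \<union> Q\<close> and
  between \<open>S\<close> and the rest to be present. The sum is convex in the part sizes, hence at most its value
  at the most unbalanced sizes; comparing with the equation for \<open>\<theta>\<close> leaves only the extremal graph.
  The cases \<open>s < \<delta>\<close> (where the minimum degree bounds all parts from below) and \<open>s > \<delta>\<close> are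
  strict.\<close>

subsection \<open>Tutte's theorem\<close>

text \<open>The number \<open>\<theta>\<close> solves an equation of degree four without a
  convenient closed form, so all estimates compare a competitor with that equation instead of with a
  value. Write \<open>r = \<delta> - k\<close> and \<open>m = n - 2 \<delta> + k - 3\<close>. The
  scale is set by the clique on \<open>m + \<delta>\<close> vertices: \<open>\<theta>\<close> lies
  above \<open>m + \<delta> - 1\<close>, by at most \<open>\<delta> / 47\<close>. The linear bound
  on \<open>n\<close> gives this precision and settles \<open>s > \<delta>\<close>, where each
  additional separator vertex takes two vertices from the large part. For
  \<open>s < \<delta>\<close> the small parts together may have quadratically many vertices in
  \<open>r\<close>, and the bound with \<open>\<delta> (\<delta> - k - 1)\<close> squared keeps
  \<open>\<theta>\<close> large against them. The delicate competitor is \<open>r = 3\<close>,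
  \<open>s = k + 1\<close>: its large clique together with \<open>S\<close> has the same order as in
  the extremal graph, so the tiny excess of \<open>\<theta>\<close> over
  \<open>m + \<delta> - 1\<close> has to be known exactly.\<close>

lemma hall_marriage:
  fixes F :: "'i \<Rightarrow> 'b set"
  assumes "finite I" "\<And>i. i \<in> I \<Longrightarrow> finite (F i)"
    and "\<And>J. J \<subseteq> I \<Longrightarrow> card J \<le> card (\<Union>(F ` J))"
  shows "\<exists>f. inj_on f I \<and> (\<forall>i\<in>I. f i \<in> F i)"
  using assms
proof (induction "card I" arbitrary: I F rule: less_induct)
  case less
  note fin = less.prems(1) and finF = less.prems(2) and hall = less.prems(3)
  show ?case
  proof (cases "I = {}")
    case False
    \<comment> \<open>Critical subfamilies, those with exactly as many elements as indices, decide
      the induction. A proper nonempty one is matched into its own union and the other indices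
      outside that union; if there is none, every nonempty proper subfamily has an element to spare,
      and an arbitrary choice for one index is harmless.\<close>
    show ?thesis
    proof (cases "\<exists>J. J \<subset> I \<and> J \<noteq> {} \<and> card (\<Union>(F ` J)) = card J")
      case True
      then obtain J where J: "J \<subset> I" "J \<noteq> {}" "card (\<Union>(F ` J)) = card J" by blast
      have finJ: "finite J" using J(1) fin finite_subset by blast
      have "\<exists>f. inj_on f J \<and> (\<forall>i\<in>J. f i \<in> F i)"
        using J(1) fin finF hall finJ
        by (intro less.hyps) (auto intro: psubset_card_mono)
      then obtain f where f: "inj_on f J" "\<And>i. i \<in> J \<Longrightarrow> f i \<in> F i" by blast
      let ?U = "\<Union>(F ` J)"
      have finU: "finite ?U" using finJ finF J(1) by auto
      have "\<exists>g. inj_on g (I - J) \<and> (\<forall>i\<in>I - J. g i \<in> F i - ?U)"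
      proof (rule less.hyps)
        show "card (I - J) < card I"
          using J fin by (intro psubset_card_mono) auto
        show "finite (I - J)" using fin by simp
        show "finite (F i - ?U)" if "i \<in> I - J" for i using that finF by simp
        show "card K \<le> card (\<Union>i\<in>K. F i - ?U)" if K: "K \<subseteq> I - J" for K
        proof -
          have finK: "finite K" using K fin finite_subset by blast
          have "card K + card J = card (K \<union> J)"
            using K finK finJ by (subst card_Un_disjoint) auto
          also have "\<dots> \<le> card (\<Union>(F ` (K \<union> J)))" using K J(1) by (intro hall) auto
          also have "\<Union>(F ` (K \<union> J)) = (\<Union>i\<in>K. F i - ?U) \<union> ?U" by auto
          also have "card \<dots> = card (\<Union>i\<in>K. F i - ?U) + card ?U"
            using finU finK K finF by (intro card_Un_disjoint) auto
          finally show ?thesis using J(3) by simp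
        qed
      qed
      then obtain g where g: "inj_on g (I - J)" "\<And>i. i \<in> I - J \<Longrightarrow> g i \<in> F i - ?U" by blast
      let ?h = "\<lambda>i. if i \<in> J then f i else g i"
      have "inj_on ?h I"
      proof (rule inj_onI)
        fix i j assume ij: "i \<in> I" "j \<in> I" "?h i = ?h j"
        show "i = j"
        proof (cases "i \<in> J"; cases "j \<in> J")
          assume "i \<in> J" "j \<in> J" then show ?thesis using ij f(1) by (auto dest: inj_onD)
        next
          assume a: "i \<in> J" "j \<notin> J"
          then show ?thesis using ij f(2)[of i] g(2)[of j] by auto
        next
          assume a: "i \<notin> J" "j \<in> J"
          have "g i = f j" using ij(3) a by simp
          then show ?thesis using ij a f(2)[of j] g(2)[of i] by auto
        next
          assume "i \<notin> J" "j \<notin> J" then show ?thesis using ij g(1) by (auto dest: inj_onD)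
        qed
      qed
      moreover have "\<forall>i\<in>I. ?h i \<in> F i" using f(2) g(2) by auto
      ultimately show ?thesis by blast
    next
      case noJ: False
      obtain i where i: "i \<in> I" using False by blast
      have "card {i} \<le> card (\<Union>(F ` {i}))" using i by (intro hall) auto
      then have "F i \<noteq> {}" by auto
      then obtain b where b: "b \<in> F i" by blast
      have "\<exists>g. inj_on g (I - {i}) \<and> (\<forall>j\<in>I - {i}. g j \<in> F j - {b})"
      proof (rule less.hyps)
        show "card (I - {i}) < card I" using i fin by (rule card_Diff1_less[rotated])
        show "finite (I - {i})" using fin by simp
        show "finite (F j - {b})" if "j \<in> I - {i}" for j using that finF by simp
        show "card K \<le> card (\<Union>j\<in>K. F j - {b})" if K: "K \<subseteq> I - {i}" for K
        proof (cases "K = {}")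
          case False
          have "K \<subset> I" using K i by blast
          then have "card K < card (\<Union>(F ` K))"
            using noJ False hall[of K] by (metis le_neq_implies_less psubset_imp_subset)
          also have "\<Union>(F ` K) \<subseteq> insert b (\<Union>j\<in>K. F j - {b})" by auto
          then have "card (\<Union>(F ` K)) \<le> card (insert b (\<Union>j\<in>K. F j - {b}))"
            using K finF finite_subset[OF K] fin by (intro card_mono) auto
          also have "\<dots> \<le> Suc (card (\<Union>j\<in>K. F j - {b}))" by (rule card_insert_le_m1) auto
          finally show ?thesis by simp
        qed simp
      qed
      then obtain g where g: "inj_on g (I - {i})" "\<And>j. j \<in> I - {i} \<Longrightarrow> g j \<in> F j - {b}" by blast
      have "inj_on (g(i := b)) I"
        using g by (auto simp: inj_on_def)
      moreover have "\<forall>j\<in>I. (g(i := b)) j \<in> F j" using g(2) b by auto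
      ultimately show ?thesis by blast
    qed
  qed simp
qed

text \<open>An isolated set is a union of components of the subgraph induced on \<open>W\<close>. Working with these
  instead of components keeps the proof of Tutte's theorem free of connectivity.\<close>

definition isolated_in :: "'a set set \<Rightarrow> 'a set \<Rightarrow> 'a set \<Rightarrow> bool" where
  "isolated_in E W P \<longleftrightarrow> P \<subseteq> W \<and> (\<forall>u\<in>P. \<forall>v\<in>W. {u, v} \<in> E \<longrightarrow> v \<in> P)"

text \<open>An odd isolated set contains an odd component, so \<open>card \<P>\<close> is at most
  the number of odd components on \<open>U - S\<close>, and bounding it by \<open>card S\<close> for
  all families is the usual Tutte condition. The family may leave some of \<open>U - S\<close>
  uncovered; this remainder is itself a candidate for a further part.\<close>

definition odd_barrier :: "'a set set \<Rightarrow> 'a set \<Rightarrow> 'a set \<Rightarrow> 'a set set \<Rightarrow> bool" where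
  "odd_barrier E U S \<P> \<longleftrightarrow> S \<subseteq> U \<and> disjoint \<P> \<and>
     (\<forall>P\<in>\<P>. isolated_in E (U - S) P \<and> odd (card P))"

lemma odd_barrier_finite: "finite U \<Longrightarrow> odd_barrier E U S \<P> \<Longrightarrow> finite \<P>"
  unfolding odd_barrier_def isolated_in_def
  by (rule finite_subset[of _ "Pow U"]) auto

lemma odd_barrier_card_Union:
  assumes "finite U" "odd_barrier E U S \<P>"
  shows "even (card (\<Union>\<P>)) \<longleftrightarrow> even (card \<P>)"
proof -
  have fin: "finite \<P>" using odd_barrier_finite[OF assms] .
  have "finite P" if "P \<in> \<P>" for P
    using assms that unfolding odd_barrier_def isolated_in_def by (meson finite_Diff finite_subset)
  then have "card (\<Union>\<P>) = (\<Sum>P\<in>\<P>. card P)"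
    using assms(2) unfolding odd_barrier_def
    by (intro card_Union_disjoint) (auto simp: disjoint_def pairwise_def disjnt_def)
  moreover have "even (\<Sum>P\<in>\<P>. card P) \<longleftrightarrow> even (card \<P>)"
    using assms(2) unfolding odd_barrier_def
    by (subst even_sum_iff[OF fin]) (auto intro!: arg_cong[where f="\<lambda>A. even (card A)"])
  ultimately show ?thesis by simp
qed

text \<open>Edges are unordered, so an edge leaving the remainder would leave some member of the
  family as well.\<close>

lemma isolated_in_rest:
  assumes "\<And>P. P \<in> \<P> \<Longrightarrow> isolated_in E W P"
  shows "isolated_in E W (W - \<Union>\<P>)"
  unfolding isolated_in_def
proof (intro conjI ballI impI)
  fix u v assume uv: "u \<in> W - \<Union>\<P>" "v \<in> W" "{u, v} \<in> E"
  show "v \<in> W - \<Union>\<P>"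
  proof (rule ccontr)
    assume "v \<notin> W - \<Union>\<P>"
    then obtain Q where Q: "Q \<in> \<P>" "v \<in> Q" using uv(2) by auto
    have "{v, u} \<in> E" "u \<in> W" using uv by (simp_all add: insert_commute)
    then have "u \<in> Q" using assms[OF Q(1)] Q(2) unfolding isolated_in_def by simp
    then show False using uv(1) Q(1) by simp
  qed
qed auto

lemma odd_barrier_insert_rest:
  assumes "odd_barrier E U S \<P>" "odd (card (U - S - \<Union>\<P>))"
  shows "odd_barrier E U S (insert (U - S - \<Union>\<P>) \<P>)" "U - S - \<Union>\<P> \<notin> \<P>"
proof -
  define R where "R = U - S - \<Union>\<P>"
  have b: "S \<subseteq> U" "disjoint \<P>" "\<And>P. P \<in> \<P> \<Longrightarrow> isolated_in E (U - S) P" "\<And>P. P \<in> \<P> \<Longrightarrow> odd (card P)"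
    using assms(1) by (simp_all add: odd_barrier_def)
  have "isolated_in E (U - S) R" unfolding R_def using b(3) by (rule isolated_in_rest)
  moreover have "R \<inter> P = {}" if "P \<in> \<P>" for P using that by (auto simp: R_def)
  ultimately show "odd_barrier E U S (insert (U - S - \<Union>\<P>) \<P>)"
    using b assms(2) unfolding odd_barrier_def R_def[symmetric] disjoint_def by (simp add: Int_commute)
  have "R \<noteq> {}" using assms(2) by (auto simp: R_def[symmetric])
  then show "U - S - \<Union>\<P> \<notin> \<P>" using R_def by blast
qed

lemma card_barrier_rest:
  assumes "finite U" "odd_barrier E U S \<P>"
  shows "card U = card S + card (\<Union>\<P>) + card (U - S - \<Union>\<P>)"
proof -
  have sub: "S \<subseteq> U" "\<Union>\<P> \<subseteq> U - S" using assms(2) unfolding odd_barrier_def isolated_in_def by auto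
  have f: "finite S" "finite (\<Union>\<P>)" using sub assms(1) by (meson finite_subset finite_Diff)+
  have "card (U - S - \<Union>\<P>) = card (U - S) - card (\<Union>\<P>)"
    using sub f by (intro card_Diff_subset) auto
  moreover have "card (U - S) = card U - card S" using sub f by (intro card_Diff_subset) auto
  moreover have "card (\<Union>\<P>) \<le> card (U - S)" using sub assms(1) by (intro card_mono) auto
  moreover have "card S \<le> card U" using sub assms(1) by (intro card_mono) auto
  ultimately show ?thesis by linarith
qed

text \<open>Modulo 2, \<open>card U\<close> is \<open>card S + card \<P>\<close> plus the size of
  the uncovered remainder. An excess of exactly one makes this remainder odd, hence a new member of
  the family.\<close>

lemma odd_barrier_parity_gap:
  assumes "finite U" "even (card U)" "odd_barrier E U S \<P>" "card \<P> > card S"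
  shows "\<exists>\<P>'. odd_barrier E U S \<P>' \<and> card \<P>' \<ge> card S + 2"
proof (cases "card \<P> \<ge> card S + 2")
  case False
  then have eq: "card \<P> = card S + 1" using assms(4) by simp
  have "odd (card (U - S - \<Union>\<P>))"
    using card_barrier_rest[OF assms(1,3)] odd_barrier_card_Union[OF assms(1,3)] assms(2) eq by presburger
  from odd_barrier_insert_rest[OF assms(3) this] odd_barrier_finite[OF assms(1,3)] eq
  show ?thesis by (intro exI[of _ "insert (U - S - \<Union>\<P>) \<P>"]) auto
qed (use assms in blast)

text \<open>Take a tight barrier, one with \<open>card \<P> = card S\<close>, whose \<open>S\<close>
  is as large as possible. Maximality makes the parts cover \<open>U - S\<close>, and makes each
  part minus any one of its vertices matchable by induction; Hall's theorem matches the parts into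
  \<open>S\<close>.\<close>

theorem tutte_matching:
  assumes "finite U" "even (card U)"
    and "\<And>S \<P>. odd_barrier E U S \<P> \<Longrightarrow> card \<P> \<le> card S"
  shows "\<exists>M \<subseteq> E. (\<forall>e\<in>M. e \<subseteq> U) \<and> (\<forall>v\<in>U. \<exists>!e. e \<in> M \<and> v \<in> e)"
  using assms
proof (induction "card U" arbitrary: U rule: less_induct)
  case less
  note fin = less.prems(1) and ev = less.prems(2) and tutte = less.prems(3)
  let ?tight = "\<lambda>S. \<exists>\<P>. odd_barrier E U S \<P> \<and> card \<P> = card S"
  have "?tight {}" by (intro exI[of _ "{}"]) (auto simp: odd_barrier_def disjoint_def)
  moreover have bnd: "\<forall>S. ?tight S \<longrightarrow> card S < Suc (card U)"
    using fin by (auto simp: odd_barrier_def less_Suc_eq_le intro: card_mono)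
  ultimately obtain S where S: "?tight S" "\<And>S'. ?tight S' \<Longrightarrow> card S' \<le> card S"
    using ex_has_greatest_nat[of ?tight "{}" card "Suc (card U)"] by (metis less_imp_le)
  then obtain \<P> where \<P>: "odd_barrier E U S \<P>" "card \<P> = card S" by blast
  have finP: "finite \<P>" using odd_barrier_finite[OF fin \<P>(1)] .
  have SU: "S \<subseteq> U" and disj: "disjoint \<P>"
    and PU: "\<And>P. P \<in> \<P> \<Longrightarrow> P \<subseteq> U - S"
    and iso: "\<And>P u v. P \<in> \<P> \<Longrightarrow> u \<in> P \<Longrightarrow> v \<in> U - S \<Longrightarrow> {u, v} \<in> E \<Longrightarrow> v \<in> P"
    and oddP: "\<And>P. P \<in> \<P> \<Longrightarrow> odd (card P)"
    using \<P>(1) unfolding odd_barrier_def isolated_in_def by blast+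
  have disjD: "P = Q" if "P \<in> \<P>" "Q \<in> \<P>" "v \<in> P" "v \<in> Q" for P Q v
    using disj that unfolding disjoint_def by blast
  have finS: "finite S" using SU fin finite_subset by blast
  \<comment> \<open>By parity the uncovered remainder has even size. Moving one of its vertices
    \<open>v\<close> into \<open>S\<close> leaves an odd remainder, which becomes a part: a tight
    barrier with a larger \<open>S\<close>.\<close>
  have cover: "U = S \<union> \<Union>\<P>"
  proof (rule ccontr)
    assume "U \<noteq> S \<union> \<Union>\<P>"
    then obtain v where v: "v \<in> U - S - \<Union>\<P>" using SU PU by blast
    let ?R = "U - S - \<Union>\<P>"
    have "even (card ?R)"
      using card_barrier_rest[OF fin \<P>(1)] odd_barrier_card_Union[OF fin \<P>(1)] ev \<P>(2) by presburger
    moreover have "card ?R = Suc (card (?R - {v}))"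
      using v fin by (metis card.remove finite_Diff)
    ultimately have odd: "odd (card (?R - {v}))" by simp
    have b: "odd_barrier E U (insert v S) \<P>"
      using \<P>(1) v unfolding odd_barrier_def isolated_in_def by blast
    have e: "U - insert v S - \<Union>\<P> = ?R - {v}" by blast
    note ins = odd_barrier_insert_rest[OF b, unfolded e, OF odd]
    have "card (insert (?R - {v}) \<P>) = Suc (card S)" using ins(2) finP \<P>(2) by simp
    moreover have "card (insert v S) = Suc (card S)" using v finS by simp
    ultimately have "?tight (insert v S)" using ins(1) by metis
    from S(2)[OF this] show False using v finS by simp
  qed
  have inner: "\<exists>M \<subseteq> E. (\<forall>e\<in>M. e \<subseteq> P - {v}) \<and> (\<forall>u\<in>P - {v}. \<exists>!e. e \<in> M \<and> u \<in> e)"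
    if P: "P \<in> \<P>" and v: "v \<in> P" for P v
  proof (rule less.hyps)
    have PsubU: "P \<subseteq> U" using PU[OF P] by blast
    have finPP: "finite P" using PsubU fin finite_subset by blast
    have cP: "card P = Suc (card (P - {v}))" using v finPP by (metis card.remove)
    show "card (P - {v}) < card U" using cP card_mono[OF fin PsubU] by simp
    show "finite (P - {v})" using finPP by simp
    show evP: "even (card (P - {v}))" using cP oddP[OF P] by simp
    fix T \<Q> assume TQ: "odd_barrier E (P - {v}) T \<Q>"
    show "card \<Q> \<le> card T"
    proof (rule ccontr)
      assume "\<not> ?thesis"
      then obtain \<Q>' where Q: "odd_barrier E (P - {v}) T \<Q>'" "card \<Q>' \<ge> card T + 2"
        using odd_barrier_parity_gap[OF _ evP TQ] finPP by auto
      have T: "T \<subseteq> P - {v}" and Qs: "\<And>Q. Q \<in> \<Q>' \<Longrightarrow> Q \<subseteq> P - {v} - T"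
        and Qodd: "\<And>Q. Q \<in> \<Q>' \<Longrightarrow> odd (card Q)" and Qdisj: "disjoint \<Q>'"
        and Qiso: "\<And>Q u w. Q \<in> \<Q>' \<Longrightarrow> u \<in> Q \<Longrightarrow> w \<in> P - {v} - T \<Longrightarrow> {u, w} \<in> E \<Longrightarrow> w \<in> Q"
        using Q(1) unfolding odd_barrier_def isolated_in_def by blast+
      \<comment> \<open>At least \<open>card S - 1 + card T + 2\<close> parts now face a separator
        of \<open>card S + card T + 1\<close> vertices, so the new barrier is tight and larger. The
        gap of two supplied by parity pays for the vertex \<open>v\<close> and for the loss of the
        part \<open>P\<close>.\<close>
      let ?S = "S \<union> insert v T" and ?P = "(\<P> - {P}) \<union> \<Q>'"
      have finT: "finite T" using T finPP finite_subset by blast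
      have cS: "card ?S = card S + Suc (card T)"
      proof -
        have "card (insert v T) = Suc (card T)" using T finT by (intro card_insert_disjoint) auto
        then show ?thesis using T PU[OF P] v finT finS by (subst card_Un_disjoint) auto
      qed
      have ne: "Q \<noteq> {}" if "Q \<in> \<Q>'" for Q using Qodd[OF that] by (metis card.empty even_zero)
      have "(\<P> - {P}) \<inter> \<Q>' = {}"
      proof (rule ccontr)
        assume "(\<P> - {P}) \<inter> \<Q>' \<noteq> {}"
        then obtain Q where q: "Q \<in> \<P>" "Q \<noteq> P" "Q \<in> \<Q>'" by blast
        obtain w where "w \<in> Q" using ne[OF q(3)] by blast
        then show False using disjD[OF q(1) P] Qs[OF q(3)] q(2) by blast
      qed
      then have cQ: "card ?P = card S - 1 + card \<Q>'"
        using finP P \<P>(2) odd_barrier_finite[OF _ Q(1)] finPP by (subst card_Un_disjoint) auto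
      have "odd_barrier E U ?S ?P"
        unfolding odd_barrier_def
      proof (intro conjI ballI)
        show "?S \<subseteq> U" using SU T v PsubU by blast
        show "disjoint ?P"
        proof (rule disjointI)
          fix A B assume AB: "A \<in> ?P" "B \<in> ?P" "A \<noteq> B"
          have mixed: "A \<inter> B = {}" if "A \<in> \<P> - {P}" "B \<in> \<Q>'" for A B
            using disjD[OF _ P, of A] that Qs[OF that(2)] by blast
          consider "A \<in> \<P> - {P}" "B \<in> \<P> - {P}" | "A \<in> \<P> - {P}" "B \<in> \<Q>'"
            | "A \<in> \<Q>'" "B \<in> \<P> - {P}" | "A \<in> \<Q>'" "B \<in> \<Q>'" using AB by blast
          then show "A \<inter> B = {}"
          proof cases
            case 1 then show ?thesis using disj AB(3) by (simp add: disjoint_def)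
          next
            case 2 then show ?thesis by (rule mixed)
          next
            case 3 then show ?thesis using mixed[OF 3(2,1)] by blast
          next
            case 4 then show ?thesis using Qdisj AB(3) by (simp add: disjoint_def)
          qed
        qed
      next
        fix A assume A: "A \<in> ?P"
        show "odd (card A)" using A oddP Qodd by blast
        show "isolated_in E (U - ?S) A"
        proof (cases "A \<in> \<Q>'")
          case True
          then show ?thesis unfolding isolated_in_def
            using Qs[OF True] PU[OF P] Qiso[OF True] iso[OF P] by blast
        next
          case False
          then have A: "A \<in> \<P>" "A \<noteq> P" using A by auto
          have "A \<inter> P = {}" using disjD[OF A(1) P] A(2) by blast
          then show ?thesis unfolding isolated_in_def
            using PU[OF A(1)] iso[OF A(1)] T v by blast
        qed
      qed
      moreover from this tutte have "card ?P \<le> card ?S" by blast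
      moreover have "card S \<ge> 1" using P finP \<P>(2) by (metis One_nat_def Suc_leI card_gt_0_iff empty_iff)
      ultimately have "?tight ?S" using cS cQ Q(2) by (intro exI[of _ ?P]) linarith
      from S(2)[OF this] show False using cS by simp
    qed
  qed
  have "\<exists>f. inj_on f \<P> \<and> (\<forall>P\<in>\<P>. f P \<in> {s \<in> S. \<exists>v\<in>P. {v, s} \<in> E})"
  proof (rule hall_marriage)
    show "finite \<P>" by (rule finP)
    show "finite {s \<in> S. \<exists>v\<in>P. {v, s} \<in> E}" for P using finS by simp
    fix \<A> assume A: "\<A> \<subseteq> \<P>"
    \<comment> \<open>Hall's condition is an instance of the Tutte condition: removing only those
      vertices of \<open>S\<close> that are adjacent to members of \<open>\<A>\<close> already
      isolates these members.\<close>
    have "odd_barrier E U (\<Union>P\<in>\<A>. {s \<in> S. \<exists>v\<in>P. {v, s} \<in> E}) \<A>"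
      unfolding odd_barrier_def
    proof (intro conjI ballI)
      show "disjoint \<A>" using disj A by (auto simp: disjoint_def)
      fix P assume P: "P \<in> \<A>"
      then show "odd (card P)" using A oddP by blast
      show "isolated_in E (U - (\<Union>P\<in>\<A>. {s \<in> S. \<exists>v\<in>P. {v, s} \<in> E})) P"
        unfolding isolated_in_def
      proof (intro conjI ballI impI)
        show "P \<subseteq> U - (\<Union>P\<in>\<A>. {s \<in> S. \<exists>v\<in>P. {v, s} \<in> E})" using PU[of P] P A by auto
        fix u v assume uv: "u \<in> P" "v \<in> U - (\<Union>P\<in>\<A>. {s \<in> S. \<exists>v\<in>P. {v, s} \<in> E})" "{u, v} \<in> E"
        then have "v \<in> U - S" using P by auto
        then show "v \<in> P" using iso[of P u v] uv P A by auto
      qed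
    qed (use SU in auto)
    then show "card \<A> \<le> card (\<Union>P\<in>\<A>. {s \<in> S. \<exists>v\<in>P. {v, s} \<in> E})" by (rule tutte)
  qed
  then obtain f where f: "inj_on f \<P>" "\<And>P. P \<in> \<P> \<Longrightarrow> f P \<in> S" "\<And>P. P \<in> \<P> \<Longrightarrow> \<exists>v\<in>P. {v, f P} \<in> E"
    by blast
  have fS: "f ` \<P> = S"
    using f(1,2) finS \<P>(2) by (intro card_subset_eq) (auto simp: card_image)
  have "\<forall>P\<in>\<P>. \<exists>v. v \<in> P \<and> {v, f P} \<in> E" using f(3) by auto
  from bchoice[OF this] obtain g
    where g: "\<And>P. P \<in> \<P> \<Longrightarrow> g P \<in> P" "\<And>P. P \<in> \<P> \<Longrightarrow> {g P, f P} \<in> E" by auto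
  have "\<forall>P\<in>\<P>. \<exists>M. M \<subseteq> E \<and> (\<forall>e\<in>M. e \<subseteq> P - {g P}) \<and> (\<forall>u\<in>P - {g P}. \<exists>!e. e \<in> M \<and> u \<in> e)"
    using inner g(1) by simp
  from bchoice[OF this] obtain N where N0: "\<forall>P\<in>\<P>. N P \<subseteq> E \<and> (\<forall>e\<in>N P. e \<subseteq> P - {g P}) \<and>
    (\<forall>u\<in>P - {g P}. \<exists>!e. e \<in> N P \<and> u \<in> e)" by (elim exE)
  have N: "N P \<subseteq> E" "e \<in> N P \<Longrightarrow> e \<subseteq> P - {g P}"
    "u \<in> P - {g P} \<Longrightarrow> \<exists>!e. e \<in> N P \<and> u \<in> e" if "P \<in> \<P>" for P e u
    using bspec[OF N0 that] by simp_all
  let ?M = "(\<Union>P\<in>\<P>. N P) \<union> (\<lambda>P. {g P, f P}) ` \<P>"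
  have inM: thesis if "e \<in> ?M" "\<And>P. P \<in> \<P> \<Longrightarrow> e \<in> N P \<Longrightarrow> thesis"
    "\<And>P. P \<in> \<P> \<Longrightarrow> e = {g P, f P} \<Longrightarrow> thesis" for e thesis using that by auto
  show ?case
  proof (intro exI[of _ ?M] conjI ballI)
    show "?M \<subseteq> E" using N(1) g(2) by auto
    show "e \<subseteq> U" if "e \<in> ?M" for e
      using that
    proof (rule inM)
      fix P assume P: "P \<in> \<P>" "e \<in> N P"
      then show ?thesis using N(2)[OF P] PU[OF P(1)] by auto
    next
      fix P assume P: "P \<in> \<P>" "e = {g P, f P}"
      then show ?thesis using g(1)[OF P(1)] f(2)[OF P(1)] PU[OF P(1)] SU by auto
    qed
    fix v assume "v \<in> U"
    then consider (S) P where "P \<in> \<P>" "v = f P" | (P) P where "P \<in> \<P>" "v \<in> P"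
      using cover fS by auto
    then show "\<exists>!e. e \<in> ?M \<and> v \<in> e"
    proof cases
      case S
      have v: "v \<in> S" using S f(2) by simp
      have "e = {g P, f P}" if e: "e \<in> ?M" "v \<in> e" for e
        using e(1)
      proof (rule inM)
        fix Q assume Q: "Q \<in> \<P>" "e \<in> N Q"
        show ?thesis using N(2)[OF Q] PU[OF Q(1)] v e(2) by auto
      next
        fix Q assume Q: "Q \<in> \<P>" "e = {g Q, f Q}"
        have "v \<noteq> g Q" using v g(1)[OF Q(1)] PU[OF Q(1)] by auto
        then have "f Q = f P" using Q(2) e(2) S(2) by auto
        then show ?thesis using inj_onD[OF f(1)] Q S(1) by blast
      qed
      then show ?thesis using S by (intro ex1I[of _ "{g P, f P}"]) auto
    next
      case P
      have v: "v \<notin> S" using PU[OF P(1)] P(2) by auto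
      have same: "Q = P" if "Q \<in> \<P>" "v \<in> Q" for Q using disjD[OF that(1) P(1) that(2) P(2)] .
      show ?thesis
      proof (cases "v = g P")
        case True
        have "e = {g P, f P}" if e: "e \<in> ?M" "v \<in> e" for e
          using e(1)
        proof (rule inM)
          fix Q assume Q: "Q \<in> \<P>" "e \<in> N Q"
          then have "v \<in> Q" "v \<noteq> g Q" using N(2)[OF Q] e(2) by auto
          then show ?thesis using same[OF Q(1)] True by simp
        next
          fix Q assume Q: "Q \<in> \<P>" "e = {g Q, f Q}"
          then have "v = g Q" using e(2) v f(2)[OF Q(1)] by auto
          then show ?thesis using same[OF Q(1)] g(1)[OF Q(1)] Q(2) by simp
        qed
        then show ?thesis using True P(1) by (intro ex1I[of _ "{g P, f P}"]) auto
      next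
        case False
        then obtain e0 where e0: "e0 \<in> N P" "v \<in> e0" "\<And>e. e \<in> N P \<Longrightarrow> v \<in> e \<Longrightarrow> e = e0"
          using N(3)[OF P(1), of v] P(2) by blast
        have uniq: "e = e0" if e: "e \<in> ?M" "v \<in> e" for e
          using e(1)
        proof (rule inM)
          fix Q assume Q: "Q \<in> \<P>" "e \<in> N Q"
          then have "v \<in> Q" using N(2)[OF Q] e(2) by auto
          then show ?thesis using same[OF Q(1)] Q(2) e(2) e0(3) by simp
        next
          fix Q assume Q: "Q \<in> \<P>" "e = {g Q, f Q}"
          then have "v = g Q" using e(2) v f(2)[OF Q(1)] by auto
          then show ?thesis using same[OF Q(1)] g(1)[OF Q(1)] False by simp
        qed
        have "e0 \<in> ?M" using e0(1) P(1) by auto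
        show ?thesis
        proof (rule ex1I)
          show "e0 \<in> ?M \<and> v \<in> e0" by (rule conjI) fact+
          show "e = e0" if "e \<in> ?M \<and> v \<in> e" for e
            using uniq[OF conjunct1[OF that] conjunct2[OF that]] .
        qed
      qed
    qed
  qed
qed

subsection \<open>Estimates for the quotient equation\<close>

text \<open>The last factor is the exact secant slope of the convex function
  \<open>x / (N - x)\<close>; it increases with both endpoints.\<close>

lemma frac_slope:
  fixes b x N :: real
  assumes "b < N" "x < N"
  shows "x / (N - x) = b / (N - b) + (x - b) * (N / ((N - b) * (N - x)))"
  using assms by (simp add: divide_simps) (simp add: algebra_simps)

text \<open>The secant slope from \<open>\<beta>\<close> to \<open>M\<close> dominates all others
  that occur. Using it for every summand makes the bound depend only on the total increase, and the
  domination is strict for a summand that moves, unless it moves exactly from \<open>\<beta>\<close>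
  to \<open>M\<close>. This equality case later fixes the part sizes.\<close>

lemma sum_frac_le:
  fixes b x :: "'i \<Rightarrow> real"
  assumes fin: "finite I" and N: "0 < N" "\<beta> < N" "M < N"
    and bx: "\<And>i. i \<in> I \<Longrightarrow> b i \<le> x i" "\<And>i. i \<in> I \<Longrightarrow> b i \<le> \<beta>" "\<And>i. i \<in> I \<Longrightarrow> x i \<le> M"
  defines "L \<equiv> (\<Sum>i\<in>I. x i / (N - x i))"
    and "R \<equiv> (\<Sum>i\<in>I. b i / (N - b i)) + (\<Sum>i\<in>I. x i - b i) * (N / ((N - \<beta>) * (N - M)))"
  shows "L \<le> R" and "L = R \<Longrightarrow> i \<in> I \<Longrightarrow> x i = b i \<or> b i = \<beta> \<and> x i = M"
proof -
  let ?K = "N / ((N - \<beta>) * (N - M))"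
  let ?g = "\<lambda>i. b i / (N - b i) + (x i - b i) * ?K"
  have R: "R = (\<Sum>i\<in>I. ?g i)"
    unfolding R_def sum.distrib sum_distrib_right ..
  have le: "x i / (N - x i) \<le> ?g i"
    and eq: "x i / (N - x i) = ?g i \<Longrightarrow> x i = b i \<or> b i = \<beta> \<and> x i = M" if i: "i \<in> I" for i
  proof -
    have lt: "b i < N" "x i < N" using bx(2,3)[OF i] N by linarith+
    note fs = frac_slope[OF lt]
    have p: "(N - \<beta>) * (N - M) \<le> (N - b i) * (N - x i)"
      using bx(2,3)[OF i] N by (intro mult_mono) auto
    have pos: "0 < (N - \<beta>) * (N - M)" using N by simp
    have "N / ((N - b i) * (N - x i)) \<le> ?K"
      using p pos N(1) by (intro divide_left_mono) (auto intro: mult_pos_pos simp: lt)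
    then show "x i / (N - x i) \<le> ?g i"
      unfolding fs using bx(1)[OF i] by (intro add_left_mono mult_left_mono) auto
    assume e: "x i / (N - x i) = ?g i"
    show "x i = b i \<or> b i = \<beta> \<and> x i = M"
    proof (cases "x i = b i")
      case False
      then have "N / ((N - b i) * (N - x i)) = ?K" using e unfolding fs by simp
      then have q: "(N - b i) * (N - x i) = (N - \<beta>) * (N - M)"
        using N pos lt by (simp add: divide_simps)
      have "b i = \<beta>"
      proof (rule ccontr)
        assume "b i \<noteq> \<beta>"
        then have "(N - \<beta>) * (N - M) < (N - b i) * (N - M)"
          using bx(2)[OF i] N by (intro mult_strict_right_mono) auto
        also have "\<dots> \<le> (N - b i) * (N - x i)"
          using bx(3)[OF i] lt by (intro mult_left_mono) auto
        finally show False using q by simp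
      qed
      then show ?thesis using q N by auto
    qed simp
  qed
  show "L \<le> R" unfolding R L_def by (rule sum_mono) (rule le)
  assume LR: "L = R" and i: "i \<in> I"
  have "(\<Sum>i\<in>I. ?g i - x i / (N - x i)) = 0"
    using LR unfolding R L_def by (simp add: sum_subtractf)
  then have "?g i - x i / (N - x i) = 0"
    using fin le i by (subst (asm) sum_nonneg_eq_0_iff) auto
  then show "x i = b i \<or> b i = \<beta> \<and> x i = M" using eq[OF i] by simp
qed

text \<open>When the total increase is \<open>M - \<beta>\<close>, this identifies the bound of
  \<open>sum_frac_le\<close> with the value at the sizes where a single part of base size
  \<open>\<beta>\<close> takes all of it.\<close>

lemma frac_merge:
  fixes \<beta> M N :: real
  assumes "\<beta> < N" "M < N"
  shows "\<beta> / (N - \<beta>) + (M - \<beta>) * (N / ((N - \<beta>) * (N - M))) = M / (N - M)"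
  using frac_slope[OF assms] by simp

text \<open>The equation is the eigenvalue equation at a vertex of the joining clique, for the
  vector with weight 1 there and weight \<open>d / (\<theta> + 1 - q)\<close> on a clique of order
  \<open>q\<close>. The root comes from the intermediate value theorem.\<close>

lemma extremal_root_exists:
  fixes d m r :: real
  assumes "d \<ge> 1" "m \<ge> 3" "r \<ge> 0"
  shows "\<exists>\<theta>. m + d - 1 < \<theta> \<and>
    \<theta> = d - 1 + d * (m / (\<theta> + 1 - m) + 3 / (\<theta> - 2) + r / \<theta>)"
proof -
  define f where "f \<theta> = \<theta> - (d - 1 + d * (m / (\<theta> + 1 - m) + 3 / (\<theta> - 2) + r / \<theta>))" for \<theta>
  define a where "a = m + d - 1"
  \<comment> \<open>Here all three denominators are at least \<open>d\<close>, so the fractions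
    contribute at most \<open>m + 3 + r\<close> and \<open>f b\<close> is at least 1. At
    \<open>a\<close> the term of the large clique is exactly \<open>m\<close>, and the others push
    \<open>f\<close> below zero.\<close>
  define b where "b = m + d + r + 3"
  have "d * (m / (a + 1 - m)) = m" using assms by (simp add: a_def)
  then have "f a = - d * (3 / (a - 2) + r / a)"
    unfolding f_def distrib_left by (simp add: a_def)
  moreover have "3 / (a - 2) > 0" using assms by (intro divide_pos_pos) (auto simp: a_def)
  moreover have "r / a \<ge> 0" using assms by (auto simp: a_def)
  ultimately have fa: "f a < 0" using assms by (simp add: mult_pos_pos add_pos_nonneg)
  have part: "d * (c / y) \<le> c" if "c \<ge> 0" "y \<ge> d" for c y :: real
  proof -
    have "c * (d / y) \<le> c * 1" using that assms by (intro mult_left_mono) (auto simp: divide_simps)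
    then show ?thesis by (simp add: ac_simps)
  qed
  have "d * (m / (b + 1 - m)) \<le> m" "d * (3 / (b - 2)) \<le> 3" "d * (r / b) \<le> r"
    using assms by (intro part; simp add: b_def)+
  then have fb: "f b > 0" by (simp add: f_def b_def distrib_left)
  have "continuous_on {a..b} f"
    unfolding f_def using assms by (intro continuous_intros) (auto simp: a_def)
  then obtain \<theta> where "a \<le> \<theta>" "\<theta> \<le> b" "f \<theta> = 0"
    using IVT'[of f a 0 b] fa fb assms by (auto simp: a_def b_def)
  moreover from this have "\<theta> \<noteq> a" using fa by auto
  ultimately show ?thesis by (intro exI[of _ \<theta>]) (auto simp: f_def a_def)
qed

text \<open>Here \<open>\<theta> + 1 - m - d\<close> is the excess of the spectral radius over that of the clique
  on \<open>m + d\<close> vertices.\<close>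

lemma extremal_root_excess:
  fixes d m r \<theta> :: real
  assumes "d \<ge> 1" "m \<ge> 3" and \<theta>: "m + d - 1 < \<theta>"
    and root: "\<theta> = d - 1 + d * (m / (\<theta> + 1 - m) + 3 / (\<theta> - 2) + r / \<theta>)"
  shows "(\<theta> + 1) * (\<theta> + 1 - m - d) = (\<theta> + 1 - m) * d * (3 / (\<theta> - 2) + r / \<theta>)"
proof -
  define D where "D = \<theta> + 1 - m"
  define z where "z = 3 / (\<theta> - 2) + r / \<theta>"
  have D: "D > 0" using assms by (simp add: D_def)
  have "\<theta> = d - 1 + d * (m / D + z)" using root by (simp add: D_def z_def add.assoc)
  then have "\<theta> * D = (d - 1) * D + d * m + d * z * D" using D by (simp add: field_simps)
  moreover have "m = \<theta> + 1 - D" by (simp add: D_def)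
  ultimately have "(\<theta> + 1) * (D - d) = D * d * z" by (simp only:) (simp add: algebra_simps)
  then show ?thesis by (simp add: D_def z_def)
qed

lemma extremal_excess_le:
  fixes d m r \<theta> :: real
  assumes "d \<ge> 1" "m \<ge> 3" "r \<ge> 0" and \<theta>: "m + d - 1 < \<theta>" "\<theta> \<ge> 3 * d + 4 * r + 16"
    and root: "\<theta> = d - 1 + d * (m / (\<theta> + 1 - m) + 3 / (\<theta> - 2) + r / \<theta>)"
  shows "47 * (\<theta> + 1 - m - d) \<le> d"
proof -
  define D where "D = \<theta> + 1 - m"
  have D: "D > d" using assms by (simp add: D_def)
  have "3 / (\<theta> - 2) + r / \<theta> \<le> 3 / (\<theta> - 2) + r / (\<theta> - 2)"
    using assms by (intro add_left_mono divide_left_mono) auto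
  also have "\<dots> = (r + 3) / (\<theta> - 2)" by (simp add: add_divide_distrib)
  finally have z: "3 / (\<theta> - 2) + r / \<theta> \<le> (r + 3) / (\<theta> - 2)" .
  have "(\<theta> + 1) * (D - d) \<le> D * d * ((r + 3) / (\<theta> - 2))"
    using extremal_root_excess[OF assms(1,2) \<theta>(1) root, folded D_def]
      mult_left_mono[OF z, of "D * d"] D assms(1) by simp
  then have 1: "(\<theta> + 1) * (\<theta> - 2) * (D - d) \<le> D * (d * (r + 3))"
    using assms by (simp add: divide_simps ac_simps)
  \<comment> \<open>The split follows the lower bound on \<open>\<theta>\<close>, which says
    \<open>p + q \<le> \<theta> - 2\<close>. The inequality of arithmetic and geometric means then
    yields the factor 48.\<close>
  define p q where "p = 3 * d" and "q = 4 * r + 14"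
  have "48 * (d * (r + 3)) \<le> 4 * p * q" using assms by (simp add: p_def q_def algebra_simps)
  also have "\<dots> \<le> (p + q)\<^sup>2" using sum_squares_ge_zero[of "p - q" 0] by (simp add: power2_eq_square algebra_simps)
  also have "\<dots> \<le> (\<theta> - 2)\<^sup>2" using assms by (intro power_mono) (auto simp: p_def q_def)
  also have "\<dots> \<le> (\<theta> + 1) * (\<theta> - 2)"
    unfolding power2_eq_square using assms by (intro mult_right_mono) auto
  finally have 2: "48 * (d * (r + 3)) \<le> (\<theta> + 1) * (\<theta> - 2)" .
  have "48 * (d * (r + 3)) * (D - d) \<le> (\<theta> + 1) * (\<theta> - 2) * (D - d)"
    using 2 D by (intro mult_right_mono) auto
  then have "(d * (r + 3)) * (48 * (D - d)) \<le> (d * (r + 3)) * D"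
    using 1 by (simp add: algebra_simps)
  then have "48 * (D - d) \<le> D" using assms by (subst (asm) mult_le_cancel_left_pos) auto
  then show ?thesis by (simp add: D_def)
qed

text \<open>Here \<open>t\<close> counts the separator vertices beyond \<open>d\<close>. Each of
  them brings one more singleton part, so the large part shrinks by two. Against the equation for
  \<open>\<theta>\<close> the expression changes by \<open>t * (B - A)\<close>, where
  \<open>A\<close> is the loss in the large part and \<open>B\<close> the gain in the small
  ones.\<close>

lemma separator_above_min_degree:
  fixes d m r \<theta> t :: real
  assumes "d \<ge> 1" "m \<ge> 3" "r \<ge> 0" and \<theta>: "m + d - 1 < \<theta>" "\<theta> \<ge> 3 * d + 4 * r + 16"
    and root: "\<theta> = d - 1 + d * (m / (\<theta> + 1 - m) + 3 / (\<theta> - 2) + r / \<theta>)"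
    and t: "t > 0" "2 * t \<le> m - 3"
  shows "d + t - 1 + (d + t) * ((m - 2 * t) / (\<theta> + 1 - (m - 2 * t)) + 3 / (\<theta> - 2) + (r + t) / \<theta>) < \<theta>"
proof -
  define D where "D = \<theta> + 1 - m"
  define u where "u = D + 2 * t"
  have D: "D > d" "47 * (D - d) \<le> d"
    using \<theta> extremal_excess_le[OF assms(1-3) \<theta> root] by (simp_all add: D_def)
  have u: "u \<le> \<theta> - 2" "u > 0" "D > 0" using t D assms by (simp_all add: u_def D_def)
  have \<theta>0: "\<theta> - 2 > 0" "\<theta> > 0" using assms by simp_all
  have e: "(m - 2 * t) / (\<theta> + 1 - (m - 2 * t)) = (\<theta> + 1) / u - 1"
    using u by (simp add: u_def D_def field_simps)
  have e': "m / (\<theta> + 1 - m) = (\<theta> + 1) / D - 1" using u by (simp add: D_def field_simps)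
  define A where "A = (\<theta> + 1) * (2 * d - D) / (D * u)"
  define B where "B = 3 / (\<theta> - 2) + (2 * d + t + r - d) / \<theta>"
  have "B \<le> (3 + d / 2 + r + u / 2) / (\<theta> - 2)"
  proof -
    have "(2 * d + t + r - d) / \<theta> \<le> (d + t + r) / (\<theta> - 2)"
      using assms \<theta>0 by (intro frac_le) auto
    then have "B \<le> (3 + d + t + r) / (\<theta> - 2)" unfolding B_def by (simp add: add_divide_distrib)
    also have "\<dots> \<le> (3 + d / 2 + r + u / 2) / (\<theta> - 2)"
    proof (rule divide_right_mono)
      \<comment> \<open>From \<open>u = D + 2 * t\<close> and \<open>D > d\<close>, \<open>t\<close>
        is less than \<open>(u - d) / 2\<close>.\<close>
      show "3 + d + t + r \<le> 3 + d / 2 + r + u / 2" unfolding u_def using D(1) by argo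
    qed (use \<theta>0 in simp)
    finally show ?thesis .
  qed
  also have "\<dots> < (23 / 24) * (\<theta> + 1) / u"
  proof -
    have "(3 + d / 2 + r + u / 2) * u \<le> (2 + d / 2 + r + \<theta> / 2) * (\<theta> - 2)"
      using u assms by (intro mult_mono) auto
    also have "\<dots> < ((23 / 24) * (\<theta> + 1)) * (\<theta> - 2)"
      using assms \<theta>0 by (intro mult_strict_right_mono) auto
    finally have lt: "(3 + d / 2 + r + u / 2) * u < ((23 / 24) * (\<theta> + 1)) * (\<theta> - 2)" .
    have "x / v < y / u" if "x * u < y * v" "v > 0" for x y v :: real
      using that u by (simp add: divide_simps mult.commute)
    from this[OF lt \<theta>0(1)] show ?thesis .
  qed
  also have "\<dots> \<le> A"
  proof -
    \<comment> \<open>The excess bound says \<open>D \<le> 48 / 47 * d\<close>, so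
      \<open>2 * d / D - 1\<close> is at least \<open>2 * 47 / 48 - 1\<close>.\<close>
    have "23 / 24 \<le> (2 * d - D) / D" using D u by (simp add: divide_simps)
    then have "(23 / 24) * ((\<theta> + 1) / u) \<le> ((2 * d - D) / D) * ((\<theta> + 1) / u)"
      using u \<theta>0 by (intro mult_right_mono) auto
    then show ?thesis by (simp add: A_def ac_simps)
  qed
  finally have AB: "B - A < 0" by simp
  have "t * (B - A) = (d + t) * ((\<theta> + 1) / u + 3 / (\<theta> - 2) + (r + t) / \<theta>)
     - d * ((\<theta> + 1) / D + 3 / (\<theta> - 2) + r / \<theta>)"
  proof -
    have "(d + t) * ((\<theta> + 1) / u) - d * ((\<theta> + 1) / D) = - t * A"
      unfolding A_def using u by (simp add: divide_simps) (simp add: u_def algebra_simps)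
    moreover have "(d + t) * (3 / (\<theta> - 2) + (r + t) / \<theta>) - d * (3 / (\<theta> - 2) + r / \<theta>) = t * B"
      unfolding B_def using \<theta>0 by (simp add: divide_simps) (simp add: algebra_simps)
    ultimately show ?thesis by (simp add: algebra_simps)
  qed
  moreover have "t * (B - A) < 0" using AB t by (simp add: mult_pos_neg)
  ultimately have "(d + t) * ((\<theta> + 1) / u + 3 / (\<theta> - 2) + (r + t) / \<theta>)
    < d * ((\<theta> + 1) / D + 3 / (\<theta> - 2) + r / \<theta>)" by simp
  moreover have "d * ((\<theta> + 1) / D + 3 / (\<theta> - 2) + r / \<theta>) = \<theta> + 1"
  proof -
    have "d * ((\<theta> + 1) / D - 1 + 3 / (\<theta> - 2) + r / \<theta>)
      = d * ((\<theta> + 1) / D + 3 / (\<theta> - 2) + r / \<theta>) - d" by (simp only: algebra_simps)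
    then show ?thesis using root unfolding e' by linarith
  qed
  ultimately show ?thesis unfolding e by (simp add: algebra_simps)
qed

text \<open>Clearing denominators in the quotient equation: \<open>M\<close> is the large part, \<open>c\<close> the surplus
  of \<open>\<theta> + 1 - M\<close> over \<open>s\<close>.\<close>

lemma quotient_lt_of_surplus:
  fixes s w a M \<theta> c :: real
  assumes "s > 0" "c \<ge> 0" "a < \<theta> + 1" "\<theta> + 1 > 0" and M: "M = \<theta> + 1 - s - c"
    and main: "s * w * (s + c) < (\<theta> + 1) * (\<theta> + 1 - a) * c"
  shows "s - 1 + s * (M / (\<theta> + 1 - M) + w / (\<theta> + 1 - a)) < \<theta>"
proof -
  define N where "N = \<theta> + 1"
  have "s * (w / (N - a)) < N * c / (s + c)"
    using main assms by (simp add: N_def divide_simps ac_simps)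
  moreover have "M / (N - M) = N / (s + c) - 1"
    using assms(1,2) unfolding M by (simp add: N_def field_simps)
  moreover have "s * (N / (s + c)) = N - N * c / (s + c)"
    using assms(1,2) by (simp add: field_simps)
  ultimately show ?thesis unfolding N_def[symmetric] by (simp add: distrib_left right_diff_distrib N_def)
qed

text \<open>\<open>M\<close> is what remains for the large part when \<open>j + 1\<close> parts have
  the least possible size \<open>a\<close>. With \<open>w\<close> the total of these parts, the
  surplus of \<open>\<theta> + 1 - M\<close> over \<open>s\<close> is
  \<open>c = w - r - 3 + \<epsilon>\<close>, and it suffices that \<open>c\<close> is not too small
  against \<open>w\<close>.\<close>

lemma separator_below_min_degree:
  fixes d k s j r a :: nat and m \<theta> :: real
  assumes k: "k \<ge> 1" and s: "s = k + j" "d = k + r" "1 \<le> j" "j < r" and a: "a = max (r + 1 - j) 3"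
    and m: "m \<ge> 3" and \<theta>: "m + d - 1 < \<theta>" "\<theta> \<ge> 3 * real d + 4 * real r + 16"
      "\<theta> \<ge> real d * ((real r - 1)\<^sup>2 - 2) - real r - 5"
    and root: "\<theta> = real d - 1 + d * (m / (\<theta> + 1 - m) + 3 / (\<theta> - 2) + r / \<theta>)"
    and M: "M = m + real d + real r + 3 - real s - real (j + 1) * real a"
  shows "M < \<theta> + 1"
    and "real s - 1 + s * (M / (\<theta> + 1 - M) + (real (j + 1) * real a) / (\<theta> + 1 - a)) < \<theta>"
proof -
  define \<epsilon> where "\<epsilon> = \<theta> + 1 - m - d"
  define w where "w = real (j + 1) * real a"
  define c where "c = w - r - 3 + \<epsilon>"
  have d1: "real d \<ge> 1" "real r \<ge> 2" "real d \<ge> real r + 1" "real s \<le> real d - 1" "real s > 0" using assms by auto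
  have \<epsilon>: "\<epsilon> > 0" using \<theta> by (simp add: \<epsilon>_def)
  have Meq: "M = \<theta> + 1 - real s - c" by (simp add: M c_def \<epsilon>_def w_def)
  have a_le: "real a \<le> real r + 1" using a s by auto
  have N: "\<theta> + 1 > 0" "real a < \<theta> + 1" using \<theta> a_le d1 by auto
  have ex: "(\<theta> + 1) * \<epsilon> = (d + \<epsilon>) * d * (3 / (\<theta> - 2) + r / \<theta>)"
    using extremal_root_excess[OF d1(1) m \<theta>(1) root] by (simp add: \<epsilon>_def)
  \<comment> \<open>For \<open>r = 3\<close>, \<open>j = 1\<close> the integer
    \<open>w - r - 3\<close> vanishes and \<open>c\<close> is only \<open>\<epsilon>\<close>, so the
    exact formula \<open>ex\<close> has to decide. In all other cases \<open>c\<close> is at least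
    \<open>w / 8\<close>, and coarse estimates suffice.\<close>
  have c0_main: "c > 0 \<and> s * w * (s + c) < (\<theta> + 1) * (\<theta> + 1 - a) * c"
  proof (cases "r = 3 \<and> j = 1")
    case True
    then have v: "w = 6" "real a = 3" "c = \<epsilon>" "real s = real d - 2" "real r = 3"
      using a s by (auto simp: w_def c_def)
    have "(\<theta> - 2) * (3 / (\<theta> - 2) + real r / \<theta>) = 3 + 3 * (\<theta> - 2) / \<theta>"
      using \<theta> d1 v(5) by (simp add: divide_simps)
    moreover have "3 + 3 * (\<theta> - 2) / \<theta> \<ge> 6 * (\<theta> - 2) / \<theta>"
      using \<theta> d1 by (simp add: divide_simps)
    ultimately have z: "(\<theta> - 2) * (3 / (\<theta> - 2) + r / \<theta>) \<ge> 6 * ((\<theta> - 2) / \<theta>)" by simp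
    \<comment> \<open>Equivalent to \<open>d < \<theta>\<close>: the two vertices that the separator
      lacks outweigh the factor \<open>(\<theta> - 2) / \<theta>\<close>.\<close>
    have "real d - 2 < d * ((\<theta> - 2) / \<theta>)" using \<theta> d1 by (simp add: divide_simps algebra_simps)
    have "s * w * (s + c) = 6 * (real d - 2) * (d + \<epsilon> - 2)" by (simp add: v algebra_simps)
    also have "\<dots> \<le> 6 * (real d - 2) * (d + \<epsilon>)" using \<epsilon> d1 v(5) by (intro mult_left_mono) auto
    also have "\<dots> < 6 * (d * ((\<theta> - 2) / \<theta>)) * (d + \<epsilon>)"
      using \<open>real d - 2 < _\<close> \<epsilon> d1 by (intro mult_strict_right_mono) auto
    also have "\<dots> = (d + \<epsilon>) * d * (6 * ((\<theta> - 2) / \<theta>))" by simp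
    also have "\<dots> \<le> (d + \<epsilon>) * d * ((\<theta> - 2) * (3 / (\<theta> - 2) + r / \<theta>))"
      using z \<epsilon> by (intro mult_left_mono) auto
    also have "\<dots> = (\<theta> - 2) * ((\<theta> + 1) * \<epsilon>)" unfolding ex by simp
    also have "\<dots> = (\<theta> + 1) * (\<theta> + 1 - a) * c" by (simp add: v)
    finally show ?thesis using \<epsilon> v by simp
  next
    case False
    \<comment> \<open>The first half is \<open>w \<le> 8 * (w - r - 3)\<close>, with equality at
      \<open>r = 4\<close>, \<open>j = 1\<close>, where \<open>w = 8\<close>. In the second half
      \<open>w\<close> may grow quadratically in \<open>r\<close>, so for \<open>r \<ge> 4\<close>
      it rests on \<open>\<theta>(3)\<close>; only two small pairs \<open>r\<close>,
      \<open>j\<close> remain besides.\<close>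
    have w8: "7 * w \<ge> 8 * r + 24 \<and> 8 * real s + w \<le> 3 * (\<theta> - r)"
    proof (cases "r \<ge> 4")
      case True
      have "(j + 1) * a \<ge> 2 * r"
      proof -
        obtain i where i: "r = j + 1 + i" using s(4) by (metis Suc_eq_plus1 Suc_leI le_Suc_ex)
        have "(j + 1) * (i + 2) \<ge> 2 * r" using s(3) i by (auto simp: algebra_simps)
        moreover have "a \<ge> i + 2" using a i by simp
        ultimately show ?thesis by (meson le_trans mult_le_mono2)
      qed
      then have w1: "w \<ge> 2 * r" unfolding w_def by (metis of_nat_le_iff of_nat_mult of_nat_numeral)
      have w2: "4 * w \<le> (real r + 2)\<^sup>2 + 4 * r"
      proof -
        \<comment> \<open>The maximum with 3 adds at most one, since \<open>r + 1 - j\<close> is at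
          least 2.\<close>
        have "real a \<le> (real r + 1 - real j) + 1" using a s by (auto simp: of_nat_diff)
        then have "4 * w \<le> 4 * ((real j + 1) * (real r + 1 - real j + 1))"
          unfolding w_def of_nat_add of_nat_1 by (intro mult_left_mono) auto
        also have "\<dots> \<le> (real r + 2)\<^sup>2 + 4 * (real j + 1)"
          using sum_squares_ge_zero[of "real r - 2 * real j" 0] by (simp add: power2_eq_square algebra_simps)
        also have "\<dots> \<le> (real r + 2)\<^sup>2 + 4 * r" using s by auto
        finally show ?thesis .
      qed
      define x where "x = real r - 4"
      have x: "x \<ge> 0" "real r = x + 4" using True by (auto simp: x_def)
      have "8 * real d + w \<le> 3 * (real d * ((real r - 1)\<^sup>2 - 2) - real r - 5 - r)"
      proof -
        have "(real r + 1) * (3 * (real r - 1)\<^sup>2 - 14) \<le> d * (3 * (real r - 1)\<^sup>2 - 14)"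
        proof (rule mult_right_mono)
          have "(real r - 1)\<^sup>2 \<ge> 3\<^sup>2" using x by (intro power_mono) auto
          then show "0 \<le> 3 * (real r - 1)\<^sup>2 - 14" by simp
        qed (use d1 in auto)
        moreover have "4 * ((real r + 1) * (3 * (real r - 1)\<^sup>2 - 14)) \<ge> (real r + 2)\<^sup>2 + 4 * real r + 4 * (6 * real r + 15)"
          unfolding x(2) using x(1) by (simp add: power2_eq_square algebra_simps)
        ultimately show ?thesis using w2 by (simp add: algebra_simps)
      qed
      then show ?thesis using w1 True d1 \<theta>(3) by auto
    next
      case r4: False
      then have "(r = 2 \<and> j = 1) \<or> (r = 3 \<and> j = 2)" using s False by auto
      then have "(real r = 2 \<and> w = 6) \<or> (real r = 3 \<and> w = 9)" using a by (auto simp: w_def)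
      then show ?thesis using \<theta>(2) d1 by auto
    qed
    then have c: "w \<le> 8 * c" "c > 0" "w \<ge> 0" using \<epsilon> by (auto simp: c_def)
    have "s * w * (s + c) = s * (s * w + w * c)" by (simp add: algebra_simps)
    also have "\<dots> \<le> s * (s * (8 * c) + w * c)"
      using c d1 by (intro mult_left_mono add_right_mono) auto
    also have "\<dots> = s * ((8 * s + w) * c)" by (simp add: algebra_simps)
    also have "\<dots> \<le> s * ((3 * (\<theta> - r)) * c)"
      using w8 c d1 by (intro mult_left_mono mult_right_mono) auto
    also have "\<dots> = (3 * s) * (\<theta> - r) * c" by (simp add: algebra_simps)
    also have "\<dots> < (\<theta> + 1) * (\<theta> - r) * c"
      using \<theta>(2) d1 c by (intro mult_strict_right_mono) auto
    also have "\<dots> \<le> (\<theta> + 1) * (\<theta> + 1 - a) * c"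
      using N a_le c by (intro mult_right_mono mult_left_mono) auto
    finally show ?thesis using c by simp
  qed
  show "M < \<theta> + 1" unfolding Meq using c0_main d1 by simp
  show "real s - 1 + s * (M / (\<theta> + 1 - M) + (real (j + 1) * real a) / (\<theta> + 1 - a)) < \<theta>"
    using quotient_lt_of_surplus[of s c a \<theta> M w] d1 c0_main N Meq by (simp add: w_def)
qed

subsection \<open>Spectral bounds\<close>

text \<open>Makes the set under \<open>Max\<close> in the spectral radius nonempty. A complex
  eigenvalue \<open>\<mu>\<close> exists; the Hermitian form \<open>z\<close> at its eigenvector
  equals \<open>\<mu> * q\<close> with \<open>q\<close> real and nonzero, and by symmetry it is its
  own conjugate. So \<open>\<mu>\<close> is real, and a root of the real characteristic
  polynomial.\<close>

lemma eigenvalue_symmetric_real_exists: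
  fixes A :: "real mat"
  assumes A: "A \<in> carrier_mat n n" and n: "n > 0"
    and sym: "\<And>i j. i < n \<Longrightarrow> j < n \<Longrightarrow> A $$ (i, j) = A $$ (j, i)"
  shows "\<exists>\<theta>. eigenvalue A \<theta>"
proof -
  let ?C = "map_mat complex_of_real A"
  have C: "?C \<in> carrier_mat n n" using A by simp
  obtain \<mu> where \<mu>: "eigenvalue ?C \<mu>"
    using spectrum_non_empty[OF C] n unfolding spectrum_def by auto
  then obtain v where v: "v \<in> carrier_vec n" "v \<noteq> 0\<^sub>v n" "?C *\<^sub>v v = \<mu> \<cdot>\<^sub>v v"
    unfolding eigenvalue_def eigenvector_def using C by auto
  define z where "z = (\<Sum>i<n. \<Sum>j<n. of_real (A $$ (i, j)) * (cnj (v $ i) * v $ j))"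
  define q where "q = (\<Sum>i<n. (cmod (v $ i))\<^sup>2)"
  have row: "(\<Sum>j<n. of_real (A $$ (i, j)) * v $ j) = \<mu> * v $ i" if "i < n" for i
  proof -
    have "(?C *\<^sub>v v) $ i = (\<Sum>j<n. of_real (A $$ (i, j)) * v $ j)"
      using that A v(1) by (simp add: scalar_prod_def atLeast0LessThan)
    then show ?thesis using v(1,3) that by simp
  qed
  have "z = (\<Sum>i<n. cnj (v $ i) * (\<Sum>j<n. of_real (A $$ (i, j)) * v $ j))"
    unfolding z_def sum_distrib_left by (intro sum.cong refl) (simp add: ac_simps)
  also have "\<dots> = (\<Sum>i<n. \<mu> * of_real ((cmod (v $ i))\<^sup>2))"
  proof (intro sum.cong refl)
    fix i assume "i \<in> {..<n}"
    then have "cnj (v $ i) * (\<Sum>j<n. of_real (A $$ (i, j)) * v $ j) = cnj (v $ i) * (\<mu> * v $ i)"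
      by (simp only: lessThan_iff row)
    also have "\<dots> = \<mu> * of_real ((cmod (v $ i))\<^sup>2)" by (simp only: complex_norm_square ac_simps)
    finally show "cnj (v $ i) * (\<Sum>j<n. of_real (A $$ (i, j)) * v $ j) = \<mu> * of_real ((cmod (v $ i))\<^sup>2)" .
  qed
  finally have zq: "z = \<mu> * of_real q" unfolding q_def by (simp add: sum_distrib_left)
  have "cnj z = (\<Sum>i<n. \<Sum>j<n. of_real (A $$ (i, j)) * (cnj (v $ j) * v $ i))"
    unfolding z_def by (simp add: ac_simps)
  also have "\<dots> = (\<Sum>j<n. \<Sum>i<n. of_real (A $$ (i, j)) * (cnj (v $ j) * v $ i))"
    by (rule sum.swap)
  also have "\<dots> = z" unfolding z_def using sym by (intro sum.cong refl) simp
  finally have "cnj z = z" .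
  then have "(cnj \<mu> - \<mu>) * of_real q = 0" unfolding zq by (simp add: algebra_simps)
  moreover have "q \<noteq> 0"
  proof
    assume "q = 0"
    then have "v $ i = 0" if "i < n" for i
      using that unfolding q_def by (subst (asm) sum_nonneg_eq_0_iff) auto
    then have "v = 0\<^sub>v n" using v(1) by (intro eq_vecI) auto
    then show False using v(2) by simp
  qed
  ultimately have "cnj \<mu> = \<mu>" by simp
  then have \<mu>r: "\<mu> = of_real (Re \<mu>)" by (simp add: complex_eq_iff)
  have "poly (char_poly ?C) \<mu> = 0" using \<mu> eigenvalue_root_char_poly[OF C] by simp
  then have "poly (map_poly complex_of_real (char_poly A)) (of_real (Re \<mu>)) = 0"
    using of_real_hom.char_poly_hom[OF A] \<mu>r by metis
  then have "complex_of_real (poly (char_poly A) (Re \<mu>)) = 0"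
    using of_real_hom.poly_map_poly[of "char_poly A" "Re \<mu>"] by metis
  then show ?thesis using eigenvalue_root_char_poly[OF A] by auto
qed

definition nbrs :: "'a sgraph \<Rightarrow> 'a \<Rightarrow> 'a set" where
  "nbrs G u = {v \<in> verts G. {u, v} \<in> edges G}"

lemma simple_graphD:
  assumes "simple_graph G"
  shows "finite (verts G)" "{u, v} \<in> edges G \<Longrightarrow> u \<in> verts G" "{u, v} \<in> edges G \<Longrightarrow> v \<in> verts G"
    "{u, v} \<in> edges G \<Longrightarrow> u \<noteq> v" "finite (edges G)"
proof -
  show "finite (verts G)" using assms by (simp add: simple_graph_def)
  show "u \<in> verts G" "v \<in> verts G" "u \<noteq> v" if "{u, v} \<in> edges G"
    using assms that by (auto simp: simple_graph_def)
  show "finite (edges G)"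
    using assms by (intro finite_subset[of "edges G" "Pow (verts G)"]) (auto simp: simple_graph_def)
qed

lemma eigenvalue_adj_matrix_iff:
  assumes "finite (verts G)"
  shows "eigenvalue (adj_matrix G) \<theta> \<longleftrightarrow>
    (\<exists>x. (\<exists>v \<in> verts G. x v \<noteq> 0) \<and> (\<forall>u \<in> verts G. (\<Sum>v\<in>nbrs G u. x v) = \<theta> * x u))"
proof -
  obtain vs where vs: "distinct vs" "set vs = verts G" using finite_distinct_list[OF assms] by blast
  have "(\<Sum>v\<in>verts G. (if {u, v} \<in> edges G then 1 else 0) * x v) = (\<Sum>v\<in>nbrs G u. x v)"
    for u and x :: "'a \<Rightarrow> real"
    unfolding nbrs_def using assms
    by (subst sum.inter_filter) (auto intro!: sum.cong)
  then show ?thesis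
    unfolding eigenvalue_adj_matrix_eq[OF vs] eigenvalue_adj_matrix_wrt_iff[OF vs] by simp
qed

lemma spectral_radius_graph:
  assumes "finite (verts G)" "verts G \<noteq> {}"
  shows "eigenvalue (adj_matrix G) (spectral_radius_graph G)"
    and "eigenvalue (adj_matrix G) \<theta> \<Longrightarrow> \<theta> \<le> spectral_radius_graph G"
proof -
  obtain vs where vs: "distinct vs" "set vs = verts G" using finite_distinct_list[OF assms(1)] by blast
  let ?A = "adj_matrix_wrt vs G"
  have A: "?A \<in> carrier_mat (length vs) (length vs)" by (simp add: adj_matrix_wrt_def)
  have len: "length vs > 0" using assms(2) vs(2) by auto
  have "\<exists>\<theta>. eigenvalue ?A \<theta>"
    by (rule eigenvalue_symmetric_real_exists[OF A len]) (simp add: adj_matrix_wrt_def insert_commute)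
  then have ne: "{\<theta>. eigenvalue (adj_matrix G) \<theta>} \<noteq> {}"
    using eigenvalue_adj_matrix_eq[OF vs] by simp
  have "finite {\<theta>. eigenvalue ?A \<theta>}" using card_finite_spectrum[OF A] by (simp add: spectrum_def)
  then have fin: "finite {\<theta>. eigenvalue (adj_matrix G) \<theta>}"
    using eigenvalue_adj_matrix_eq[OF vs] by simp
  show "eigenvalue (adj_matrix G) (spectral_radius_graph G)"
    using Max_in[OF fin ne] unfolding spectral_radius_graph_def by simp
  show "eigenvalue (adj_matrix G) \<theta> \<Longrightarrow> \<theta> \<le> spectral_radius_graph G"
    using Max_ge[OF fin] unfolding spectral_radius_graph_def by simp
qed

section \<open>Positive supersolutions of the eigenvalue equation on connected graphs\<close>

lemma connected_graph_closed_set: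
  assumes "simple_graph H" "connected_graph H" "P \<noteq> {}" "P \<subseteq> verts H"
    and closed: "\<And>u v. u \<in> P \<Longrightarrow> v \<in> verts H \<Longrightarrow> {u, v} \<in> edges H \<Longrightarrow> v \<in> P"
  shows "P = verts H"
proof
  obtain u where u: "u \<in> P" using assms(3) by blast
  show "verts H \<subseteq> P"
  proof
    fix v assume "v \<in> verts H"
    then have "(u, v) \<in> {(x, y). {x, y} \<in> edges H}\<^sup>*"
      using assms(2,4) u unfolding connected_graph_def by blast
    then show "v \<in> P"
      by (induction rule: rtrancl_induct) (use u closed simple_graphD(3)[OF assms(1)] in auto)
  qed
qed (rule assms(4))

text \<open>A maximiser of \<open>\<bar>x v\<bar> / y v\<close> for an eigenvector \<open>x\<close> forces its neighbours to be maximisers.\<close>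

lemma positive_supersolution_tight:
  assumes G: "simple_graph G" "connected_graph G"
    and y: "\<And>v. v \<in> verts G \<Longrightarrow> y v > 0"
    and super: "\<And>u. u \<in> verts G \<Longrightarrow> (\<Sum>v\<in>nbrs G u. y v) \<le> \<theta> * y u"
    and ev: "eigenvalue (adj_matrix G) \<kappa>" and \<theta>: "\<theta> \<le> \<kappa>" "0 < \<theta>"
    and u: "u \<in> verts G"
  shows "(\<Sum>v\<in>nbrs G u. y v) = \<theta> * y u"
proof -
  note fin = simple_graphD(1)[OF G(1)]
  obtain x where x: "\<exists>v \<in> verts G. x v \<noteq> 0"
    "\<And>u. u \<in> verts G \<Longrightarrow> (\<Sum>v\<in>nbrs G u. x v) = \<kappa> * x u"
    using ev unfolding eigenvalue_adj_matrix_iff[OF fin] by blast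
  have ne: "verts G \<noteq> {}" using u by blast
  define \<mu> where "\<mu> = Max ((\<lambda>v. \<bar>x v\<bar> / y v) ` verts G)"
  have le: "\<bar>x v\<bar> \<le> \<mu> * y v" if "v \<in> verts G" for v
  proof -
    have "\<bar>x v\<bar> / y v \<le> \<mu>" unfolding \<mu>_def using fin that by (intro Max_ge) auto
    then show ?thesis using y[OF that] by (simp add: divide_simps)
  qed
  have \<mu>: "\<mu> > 0"
  proof -
    obtain v where v: "v \<in> verts G" "x v \<noteq> 0" using x(1) by blast
    then have "0 < \<mu> * y v" using le[OF v(1)] by auto
    then show ?thesis using y[OF v(1)] by (simp add: zero_less_mult_iff)
  qed
  define W where "W = {v \<in> verts G. \<bar>x v\<bar> = \<mu> * y v}"
  have "\<mu> \<in> (\<lambda>v. \<bar>x v\<bar> / y v) ` verts G" unfolding \<mu>_def using fin ne by (intro Max_in) auto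
  then obtain v0 where v0: "v0 \<in> verts G" "\<mu> = \<bar>x v0\<bar> / y v0" by blast
  then have "v0 \<in> W" unfolding W_def using y[OF v0(1)] by simp
  then have Wne: "W \<noteq> {}" by blast
  have finN: "finite (nbrs G w)" and subN: "nbrs G w \<subseteq> verts G" for w
    unfolding nbrs_def using fin by auto
  have tight: "(\<Sum>v\<in>nbrs G w. y v) = \<theta> * y w" "nbrs G w \<subseteq> W" if w: "w \<in> W" for w
  proof -
    have wV: "w \<in> verts G" and xw: "\<bar>x w\<bar> = \<mu> * y w" using w by (auto simp: W_def)
    \<comment> \<open>The chain that begins here starts and ends at the same value, so all its
      inequalities are equalities: the supersolution is tight at \<open>w\<close>, and every
      neighbour of \<open>w\<close> attains the maximum.\<close>
    have "\<theta> * (\<mu> * y w) \<le> \<kappa> * (\<mu> * y w)" using \<theta> \<mu> y[OF wV] by (intro mult_right_mono) auto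
    also have "\<dots> = \<bar>\<Sum>v\<in>nbrs G w. x v\<bar>" unfolding x(2)[OF wV] abs_mult xw[symmetric] using \<theta> by simp
    also have "\<dots> \<le> (\<Sum>v\<in>nbrs G w. \<bar>x v\<bar>)" by (rule sum_abs)
    finally have 1: "\<theta> * (\<mu> * y w) \<le> (\<Sum>v\<in>nbrs G w. \<bar>x v\<bar>)" .
    have 2: "(\<Sum>v\<in>nbrs G w. \<bar>x v\<bar>) \<le> (\<Sum>v\<in>nbrs G w. \<mu> * y v)"
      using le subN by (intro sum_mono) blast
    have 3: "(\<Sum>v\<in>nbrs G w. \<mu> * y v) \<le> \<mu> * (\<theta> * y w)"
      unfolding sum_distrib_left[symmetric] using super[OF wV] \<mu> by (intro mult_left_mono) auto
    have e3: "(\<Sum>v\<in>nbrs G w. \<mu> * y v) = \<mu> * (\<theta> * y w)" using 1 2 3 by (simp add: ac_simps)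
    then show "(\<Sum>v\<in>nbrs G w. y v) = \<theta> * y w" using \<mu> unfolding sum_distrib_left[symmetric] by simp
    have "(\<Sum>v\<in>nbrs G w. \<mu> * y v - \<bar>x v\<bar>) = 0" using 1 2 3 by (simp add: sum_subtractf ac_simps)
    then have "\<forall>v\<in>nbrs G w. \<mu> * y v - \<bar>x v\<bar> = 0"
      using finN le subN by (subst (asm) sum_nonneg_eq_0_iff) (auto simp: subset_iff)
    then show "nbrs G w \<subseteq> W" using subN unfolding W_def by auto
  qed
  have "W = verts G"
  proof (rule connected_graph_closed_set[OF G Wne])
    show "W \<subseteq> verts G" by (auto simp: W_def)
    fix a b assume ab: "a \<in> W" "b \<in> verts G" "{a, b} \<in> edges G"
    then show "b \<in> W" using tight(2)[OF ab(1)] by (auto simp: nbrs_def)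
  qed
  then show ?thesis using tight(1) u by blast
qed

lemma sum_eq_superset_imp_eq:
  fixes f :: "'b \<Rightarrow> real"
  assumes "finite B" "A \<subseteq> B" "\<And>x. x \<in> B \<Longrightarrow> f x > 0" "sum f B \<le> sum f A"
  shows "A = B"
proof (rule ccontr)
  assume "A \<noteq> B"
  then have "B - A \<noteq> {}" using assms(2) by blast
  then have "sum f (B - A) > 0" using assms by (intro sum_pos) auto
  moreover have "sum f B = sum f (B - A) + sum f A" using assms by (intro sum.subset_diff)
  ultimately show False using assms(4) by simp
qed

text \<open>The weight on \<open>Q\<close> solves
  \<open>s + (card Q - 1) * y = \<theta> * y\<close>, so a vertex adjacent to all of
  \<open>S\<close> and to the rest of its part meets the eigenvalue equation exactly, while
  \<open>bound\<close> is the inequality at \<open>S\<close>. Missing edges only lower neighbour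
  sums, hence the vector is a supersolution in any case; once it is tight everywhere, positivity
  leaves no room for a missing edge.\<close>

lemma clique_join_bound_tight:
  fixes G :: "'a sgraph" and \<theta> :: real
  assumes G: "simple_graph G" "connected_graph G"
    and S: "S \<subseteq> verts G" "S \<noteq> {}"
    and parts: "disjoint \<Q>" "\<Union>\<Q> = verts G - S"
    and iso: "\<And>Q u v. Q \<in> \<Q> \<Longrightarrow> u \<in> Q \<Longrightarrow> v \<in> verts G - S \<Longrightarrow> {u, v} \<in> edges G \<Longrightarrow> v \<in> Q"
    and \<theta>: "0 < \<theta>" "\<And>Q. Q \<in> \<Q> \<Longrightarrow> real (card Q) < \<theta> + 1"
    and bound: "real (card S) - 1 + card S * (\<Sum>Q\<in>\<Q>. card Q / (\<theta> + 1 - card Q)) \<le> \<theta>"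
    and \<rho>: "\<theta> \<le> spectral_radius_graph G"
  shows "real (card S) - 1 + card S * (\<Sum>Q\<in>\<Q>. card Q / (\<theta> + 1 - card Q)) = \<theta>"
    and "u \<in> S \<Longrightarrow> v \<in> verts G \<Longrightarrow> u \<noteq> v \<Longrightarrow> {u, v} \<in> edges G"
    and "Q \<in> \<Q> \<Longrightarrow> u \<in> Q \<Longrightarrow> v \<in> Q \<Longrightarrow> u \<noteq> v \<Longrightarrow> {u, v} \<in> edges G"
proof -
  note fin = simple_graphD(1)[OF G(1)]
  have finS: "finite S" using S fin finite_subset by blast
  have QV: "Q \<subseteq> verts G - S" if "Q \<in> \<Q>" for Q using parts(2) that by blast
  have finQ: "finite Q" if "Q \<in> \<Q>" for Q using QV[OF that] fin by (meson finite_Diff finite_subset)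
  have finQQ: "finite \<Q>" using QV fin by (intro finite_subset[of \<Q> "Pow (verts G)"]) auto
  define s where "s = real (card S)"
  have s: "s > 0" unfolding s_def using S finS by (simp add: card_gt_0_iff)
  define part where "part v = (THE Q. Q \<in> \<Q> \<and> v \<in> Q)" for v
  have part: "part v = Q" if "Q \<in> \<Q>" "v \<in> Q" for v Q
    unfolding part_def using that parts(1) by (intro the_equality) (auto simp: disjoint_def)
  define y where "y v = (if v \<in> S then 1 else s / (\<theta> + 1 - card (part v)))" for v
  have yS: "y v = 1" if "v \<in> S" for v using that by (simp add: y_def)
  have yQ: "y v = s / (\<theta> + 1 - card Q)" if "Q \<in> \<Q>" "v \<in> Q" for v Q
    using part[OF that] QV[OF that(1)] that(2) by (auto simp: y_def)
  have cases: "v \<in> S \<or> (\<exists>Q\<in>\<Q>. v \<in> Q)" if "v \<in> verts G" for v using that parts(2) by blast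
  have ypos: "y v > 0" if "v \<in> verts G" for v
    using cases[OF that] yS yQ \<theta>(2) s by force
  define T where "T = s - 1 + s * (\<Sum>Q\<in>\<Q>. card Q / (\<theta> + 1 - card Q))"
  have "sum y (\<Union>\<Q>) = (\<Sum>Q\<in>\<Q>. \<Sum>v\<in>Q. y v)"
    using finQ parts(1) by (subst sum.Union_disjoint) (auto simp: disjoint_def)
  also have "\<dots> = (\<Sum>Q\<in>\<Q>. s * (card Q / (\<theta> + 1 - card Q)))"
    using yQ by (intro sum.cong refl) (simp add: ac_simps)
  finally have sumQ: "sum y (verts G - S) = s * (\<Sum>Q\<in>\<Q>. card Q / (\<theta> + 1 - card Q))"
    using parts(2) by (simp add: sum_distrib_left)
  have sumS: "sum y S = s" using yS by (simp add: s_def)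
  have "sum y (verts G) = T + 1"
    using sum.subset_diff[OF S(1) fin, of y] sumQ sumS by (simp add: T_def)
  then have topS: "sum y (verts G - {u}) = T" if "u \<in> S" for u
    using that S(1) fin yS by (subst sum_diff1) auto
  have topQ: "sum y (S \<union> Q - {u}) = \<theta> * y u" if Q: "Q \<in> \<Q>" "u \<in> Q" for u Q
  proof -
    have "sum y (S \<union> Q) = sum y S + sum y Q"
      using finS finQ[OF Q(1)] QV[OF Q(1)] by (intro sum.union_disjoint) auto
    also have "sum y Q = card Q * y u" using yQ[OF Q(1)] Q(2) by simp
    finally have "sum y (S \<union> Q - {u}) = s + card Q * y u - y u"
      using Q(2) finS finQ[OF Q(1)] sumS by (subst sum_diff1) auto
    also have "s = (\<theta> + 1 - card Q) * y u" using yQ[OF Q] \<theta>(2)[OF Q(1)] by simp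
    finally show ?thesis by (simp add: algebra_simps)
  qed
  have nS: "nbrs G u \<subseteq> verts G - {u}" for u
    unfolding nbrs_def using simple_graphD(4)[OF G(1), of u u] by auto
  have nQ: "nbrs G u \<subseteq> S \<union> Q - {u}" if "Q \<in> \<Q>" "u \<in> Q" for u Q
    using nS[of u] iso[OF that] unfolding nbrs_def by auto
  have T: "T \<le> \<theta>" using bound by (simp add: T_def s_def)
  have super: "(\<Sum>v\<in>nbrs G u. y v) \<le> \<theta> * y u" if u: "u \<in> verts G" for u
  proof (cases "u \<in> S")
    case True
    have "(\<Sum>v\<in>nbrs G u. y v) \<le> sum y (verts G - {u})"
      using nS[of u] fin ypos by (intro sum_mono2) (auto intro: less_imp_le)
    then show ?thesis using topS[OF True] T yS[OF True] by simp
  next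
    case False
    then obtain Q where Q: "Q \<in> \<Q>" "u \<in> Q" using cases u by blast
    have "(\<Sum>v\<in>nbrs G u. y v) \<le> sum y (S \<union> Q - {u})"
      using nQ[OF Q] finS finQ[OF Q(1)] ypos S(1) QV[OF Q(1)]
      by (intro sum_mono2) (auto intro!: less_imp_le[OF ypos])
    then show ?thesis using topQ[OF Q] by simp
  qed
  have ne: "verts G \<noteq> {}" using S by blast
  have tight: "(\<Sum>v\<in>nbrs G u. y v) = \<theta> * y u" if "u \<in> verts G" for u
    using G ypos super spectral_radius_graph(1)[OF fin ne] \<rho> \<theta>(1) that
    by (rule positive_supersolution_tight)
  have nbS: "nbrs G u = verts G - {u}" "T = \<theta>" if u: "u \<in> S" for u
  proof -
    have uV: "u \<in> verts G" using u S by blast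
    have e: "(\<Sum>v\<in>nbrs G u. y v) = \<theta>" using tight[OF uV] yS[OF u] by simp
    show *: "nbrs G u = verts G - {u}"
      using nS[of u] fin ypos topS[OF u] T e by (intro sum_eq_superset_imp_eq[where f = y]) auto
    show "T = \<theta>" using e topS[OF u] unfolding * by simp
  qed
  obtain u0 where "u0 \<in> S" using S by blast
  then show "real (card S) - 1 + card S * (\<Sum>Q\<in>\<Q>. card Q / (\<theta> + 1 - card Q)) = \<theta>"
    using nbS(2) by (simp add: T_def s_def)
  show "{u, v} \<in> edges G" if "u \<in> S" "v \<in> verts G" "u \<noteq> v"
    using nbS(1)[OF that(1)] that unfolding nbrs_def by blast
  show "{u, v} \<in> edges G" if Q: "Q \<in> \<Q>" "u \<in> Q" "v \<in> Q" "u \<noteq> v"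
  proof -
    have uV: "u \<in> verts G" using Q QV by blast
    have "nbrs G u = S \<union> Q - {u}"
      using nQ[OF Q(1,2)] finS finQ[OF Q(1)] tight[OF uV] topQ[OF Q(1,2)] ypos S(1) QV[OF Q(1)]
      by (intro sum_eq_superset_imp_eq[where f = y]) auto
    then show ?thesis using Q unfolding nbrs_def by blast
  qed
qed

subsection \<open>The extremal graph\<close>

text \<open>The blocks of \<open>K\<^sub>s \<or> (K\<^sub>b \<union> K\<^sub>t \<union> i K\<^sub>1)\<close>.\<close>

definition four_blocks :: "'a sgraph \<Rightarrow> 'a set \<Rightarrow> 'a set \<Rightarrow> 'a set \<Rightarrow> 'a set \<Rightarrow> bool" where
  "four_blocks G S B T I \<longleftrightarrow> finite (verts G) \<and> verts G = S \<union> B \<union> T \<union> I \<and>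
     S \<inter> B = {} \<and> S \<inter> T = {} \<and> S \<inter> I = {} \<and> B \<inter> T = {} \<and> B \<inter> I = {} \<and> T \<inter> I = {} \<and>
     (\<forall>u\<in>verts G. \<forall>v\<in>verts G. {u, v} \<in> edges G \<longleftrightarrow>
        u \<noteq> v \<and> (u \<in> S \<or> v \<in> S \<or> u \<in> B \<and> v \<in> B \<or> u \<in> T \<and> v \<in> T))"

lemma four_blocks_verts: "four_blocks G S B T I \<Longrightarrow> finite (verts G) \<and> S \<subseteq> verts G"
  by (auto simp: four_blocks_def)

text \<open>Adjacency depends only on the blocks of the two ends and on whether the ends differ, so
  arbitrary bijections between corresponding blocks glue to an isomorphism.\<close>

lemma four_blocks_iso:
  assumes G: "four_blocks G S B T I" and H: "four_blocks H S' B' T' I'"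
    and c: "card S = card S'" "card B = card B'" "card T = card T'" "card I = card I'"
  shows "graph_iso G H"
proof -
  have f: "finite S" "finite B" "finite T" "finite I" "finite S'" "finite B'" "finite T'" "finite I'"
    using G H unfolding four_blocks_def by auto
  obtain f1 f2 f3 f4 where b: "bij_betw f1 S S'" "bij_betw f2 B B'" "bij_betw f3 T T'" "bij_betw f4 I I'"
    using f c by (meson finite_same_card_bij)
  have dG: "S \<inter> B = {}" "S \<inter> T = {}" "S \<inter> I = {}" "B \<inter> T = {}" "B \<inter> I = {}" "T \<inter> I = {}"
    and vG: "verts G = S \<union> B \<union> T \<union> I"
    and eG: "\<And>u v. u \<in> verts G \<Longrightarrow> v \<in> verts G \<Longrightarrow> {u, v} \<in> edges G \<longleftrightarrow>
        u \<noteq> v \<and> (u \<in> S \<or> v \<in> S \<or> u \<in> B \<and> v \<in> B \<or> u \<in> T \<and> v \<in> T)"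
    using G unfolding four_blocks_def by auto
  have dH: "S' \<inter> B' = {}" "S' \<inter> T' = {}" "S' \<inter> I' = {}" "B' \<inter> T' = {}" "B' \<inter> I' = {}" "T' \<inter> I' = {}"
    and vH: "verts H = S' \<union> B' \<union> T' \<union> I'"
    and eH: "\<And>u v. u \<in> verts H \<Longrightarrow> v \<in> verts H \<Longrightarrow> {u, v} \<in> edges H \<longleftrightarrow>
        u \<noteq> v \<and> (u \<in> S' \<or> v \<in> S' \<or> u \<in> B' \<and> v \<in> B' \<or> u \<in> T' \<and> v \<in> T')"
    using H unfolding four_blocks_def by auto
  define f where "f v = (if v \<in> S then f1 v else if v \<in> B then f2 v else if v \<in> T then f3 v else f4 v)" for v
  have g: "bij_betw f S S'" "bij_betw f B B'" "bij_betw f T T'" "bij_betw f I I'"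
  proof -
    have "bij_betw f S S' = bij_betw f1 S S'" "bij_betw f B B' = bij_betw f2 B B'"
      "bij_betw f T T' = bij_betw f3 T T'" "bij_betw f I I' = bij_betw f4 I I'"
      using dG by (intro bij_betw_cong; auto simp: f_def)+
    then show "bij_betw f S S'" "bij_betw f B B'" "bij_betw f T T'" "bij_betw f I I'"
      using b by simp_all
  qed
  have bij: "bij_betw f (verts G) (verts H)"
    unfolding vG vH using g dG dH by (intro bij_betw_combine) (auto simp: Int_Un_distrib2)
  have mem: "f v \<in> S' \<longleftrightarrow> v \<in> S" "f v \<in> B' \<longleftrightarrow> v \<in> B" "f v \<in> T' \<longleftrightarrow> v \<in> T" if "v \<in> verts G" for v
  proof -
    have "v \<in> S \<Longrightarrow> f v \<in> S'" "v \<in> B \<Longrightarrow> f v \<in> B'" "v \<in> T \<Longrightarrow> f v \<in> T'" "v \<in> I \<Longrightarrow> f v \<in> I'"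
      using g by (auto dest: bij_betwE)
    then show "f v \<in> S' \<longleftrightarrow> v \<in> S" "f v \<in> B' \<longleftrightarrow> v \<in> B" "f v \<in> T' \<longleftrightarrow> v \<in> T"
      using that dH unfolding vG by blast+
  qed
  have "{u, v} \<in> edges G \<longleftrightarrow> {f u, f v} \<in> edges H" if uv: "u \<in> verts G" "v \<in> verts G" for u v
  proof -
    have "f u = f v \<longleftrightarrow> u = v" using bij uv by (auto simp: bij_betw_def dest: inj_onD)
    moreover have "f u \<in> verts H" "f v \<in> verts H" using bij uv by (auto dest: bij_betwE)
    ultimately show ?thesis using eG[OF uv] eH mem[OF uv(1)] mem[OF uv(2)] by simp
  qed
  then show ?thesis unfolding graph_iso_def using bij by blast
qed

text \<open>The weights are those of \<open>clique_join_bound_tight\<close>; \<open>root\<close>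
  makes the total weight \<open>\<theta> + 1\<close>, which is the equation at \<open>S\<close>. An
  eigenvalue bounds the spectral radius from below, and this is the direction that the comparison
  uses.\<close>

lemma four_blocks_eigenvalue:
  fixes \<theta> :: real
  assumes G: "four_blocks G S B T I" and cT: "card T = 3" and S: "S \<noteq> {}"
    and \<theta>: "\<theta> > real (card B) - 1" "\<theta> > 2"
    and root: "\<theta> = real (card S) - 1 + card S * (card B / (\<theta> + 1 - card B) + 3 / (\<theta> - 2) + card I / \<theta>)"
  shows "eigenvalue (adj_matrix G) \<theta>"
proof -
  have fin: "finite (verts G)" and dG: "S \<inter> B = {}" "S \<inter> T = {}" "S \<inter> I = {}" "B \<inter> T = {}" "B \<inter> I = {}" "T \<inter> I = {}"
    and vG: "verts G = S \<union> B \<union> T \<union> I"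
    and eG: "\<And>u v. u \<in> verts G \<Longrightarrow> v \<in> verts G \<Longrightarrow> {u, v} \<in> edges G \<longleftrightarrow>
        u \<noteq> v \<and> (u \<in> S \<or> v \<in> S \<or> u \<in> B \<and> v \<in> B \<or> u \<in> T \<and> v \<in> T)"
    using G unfolding four_blocks_def by auto
  have f: "finite S" "finite B" "finite T" "finite I" using fin vG by auto
  define d where "d = real (card S)"
  define x where "x v = (if v \<in> S then 1 else if v \<in> B then d / (\<theta> + 1 - card B)
     else if v \<in> T then d / (\<theta> - 2) else d / \<theta>)" for v
  have xS: "x v = 1" if "v \<in> S" for v using that by (simp add: x_def)
  have xB: "x v = d / (\<theta> + 1 - card B)" if "v \<in> B" for v using that dG by (auto simp: x_def)
  have xT: "x v = d / (\<theta> - 2)" if "v \<in> T" for v using that dG by (auto simp: x_def)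
  have xI: "x v = d / \<theta>" if "v \<in> I" for v using that dG by (auto simp: x_def)
  have sS: "sum x S = d" using xS by (simp add: d_def)
  have sB: "sum x B = card B * (d / (\<theta> + 1 - card B))" using xB by simp
  have sT: "sum x T = 3 * (d / (\<theta> - 2))" using xT cT by simp
  have sI: "sum x I = card I * (d / \<theta>)" using xI by simp
  have "sum x (verts G) = sum x S + sum x B + sum x T + sum x I"
    unfolding vG using f dG by (simp add: sum.union_disjoint Int_Un_distrib2)
  also have "\<dots> = \<theta> + 1"
    unfolding sS sB sT sI using root unfolding d_def[symmetric] by (simp add: algebra_simps)
  finally have tot: "sum x (verts G) = \<theta> + 1" .
  have "(\<Sum>v\<in>nbrs G u. x v) = \<theta> * x u" if u: "u \<in> verts G" for u
  proof -
    consider "u \<in> S" | "u \<in> B" | "u \<in> T" | "u \<in> I" using u vG by blast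
    then show ?thesis
    proof cases
      case 1
      have "nbrs G u = verts G - {u}" unfolding nbrs_def using 1 u eG[OF u] by auto
      then show ?thesis using tot xS[OF 1] u fin by (simp add: sum_diff1)
    next
      case 2
      have "nbrs G u = (S \<union> B) - {u}" unfolding nbrs_def using 2 u eG[OF u] vG dG by auto
      then have "(\<Sum>v\<in>nbrs G u. x v) = d + card B * x u - x u"
        using 2 f dG sS sB xB[OF 2] by (simp add: sum_diff1 sum.union_disjoint)
      also have "d = (\<theta> + 1 - card B) * x u" using xB[OF 2] \<theta> by simp
      finally show ?thesis by (simp add: algebra_simps)
    next
      case 3
      have "nbrs G u = (S \<union> T) - {u}" unfolding nbrs_def using 3 u eG[OF u] vG dG by auto
      then have "(\<Sum>v\<in>nbrs G u. x v) = d + 3 * x u - x u"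
        using 3 f dG sS sT xT[OF 3] by (simp add: sum_diff1 sum.union_disjoint)
      also have "d = (\<theta> - 2) * x u" using xT[OF 3] \<theta> by simp
      finally show ?thesis by (simp add: algebra_simps)
    next
      case 4
      have "nbrs G u = S" unfolding nbrs_def using 4 u eG[OF u] vG dG by auto
      then show ?thesis using sS xI[OF 4] \<theta> by simp
    qed
  qed
  moreover have "\<exists>v\<in>verts G. x v \<noteq> 0" using S xS vG by fastforce
  ultimately show ?thesis unfolding eigenvalue_adj_matrix_iff[OF fin] by blast
qed

section \<open>Adjacency in disjoint unions, joins and complete graphs\<close>

lemma edge_image_iff:
  assumes "inj f"
  shows "{f a, f b} \<in> (`) f ` E \<longleftrightarrow> {a, b} \<in> E"
proof -
  have "f ` {a, b} \<in> (`) f ` E \<longleftrightarrow> (\<exists>e\<in>E. {a, b} = e)"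
    using inj_image_eq_iff[OF assms] by (auto simp only: image_iff)
  then show ?thesis by simp
qed

lemma edges_disjoint_union:
  "{Inl a, Inl b} \<in> edges (disjoint_union G H) \<longleftrightarrow> {a, b} \<in> edges G"
  "{Inr c, Inr e} \<in> edges (disjoint_union G H) \<longleftrightarrow> {c, e} \<in> edges H"
  "{Inl a, Inr c} \<notin> edges (disjoint_union G H)"
  "{Inr c, Inl a} \<notin> edges (disjoint_union G H)"
proof -
  have noR: "z \<notin> (`) Inr ` edges H" if "Inl a' \<in> z" for z a' using that by auto
  have noL: "z \<notin> (`) Inl ` edges G" if "Inr c' \<in> z" for z c' using that by auto
  have e: "z \<in> edges (disjoint_union G H) \<longleftrightarrow> z \<in> (`) Inl ` edges G \<or> z \<in> (`) Inr ` edges H" for z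
    by (simp add: disjoint_union_def)
  show "{Inl a, Inl b} \<in> edges (disjoint_union G H) \<longleftrightarrow> {a, b} \<in> edges G"
    unfolding e using edge_image_iff[of Inl a b "edges G"] noR[of a "{Inl a, Inl b}"] by simp
  show "{Inr c, Inr e} \<in> edges (disjoint_union G H) \<longleftrightarrow> {c, e} \<in> edges H"
    unfolding e using edge_image_iff[of Inr c e "edges H"] noL[of c "{Inr c, Inr e}"] by simp
  show "{Inl a, Inr c} \<notin> edges (disjoint_union G H)" "{Inr c, Inl a} \<notin> edges (disjoint_union G H)"
    unfolding e by (intro notI, elim disjE; use noR[of a] noL[of c] in blast)+
qed

lemma edges_join:
  "{Inl a, Inl b} \<in> edges (join G H) \<longleftrightarrow> {a, b} \<in> edges G"
  "{Inr c, Inr e} \<in> edges (join G H) \<longleftrightarrow> {c, e} \<in> edges H"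
  "{Inl a, Inr c} \<in> edges (join G H) \<longleftrightarrow> a \<in> verts G \<and> c \<in> verts H"
  "{Inr c, Inl a} \<in> edges (join G H) \<longleftrightarrow> a \<in> verts G \<and> c \<in> verts H"
  using edges_disjoint_union[where G = G and H = H] by (auto simp: join_def doubleton_eq_iff)

lemma edges_complete_graph: "{u, v} \<in> edges (complete_graph m) \<longleftrightarrow> u < m \<and> v < m \<and> u \<noteq> v"
  by (auto simp: complete_graph_def doubleton_eq_iff)

lemma join_cliques_four_blocks:
  "four_blocks (join (complete_graph d)
       (disjoint_union (disjoint_union (complete_graph m) (complete_graph t)) (copies r (complete_graph 1))))
     (Inl ` {..<d}) (Inr ` Inl ` Inl ` {..<m}) (Inr ` Inl ` Inr ` {..<t}) (Inr ` Inr ` ({..<r} \<times> {0}))"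
    (is "four_blocks ?X ?S ?B ?T ?I")
proof -
  have E0: "edges (copies r (complete_graph 1)) = {}"
    by (auto simp: copies_def complete_graph_def)
  have V0: "verts (copies r (complete_graph 1)) = {..<r} \<times> {0}" "verts (complete_graph a) = {..<a}" for a
    by (auto simp: copies_def complete_graph_def)
  have V1: "verts (disjoint_union G H) = Inl ` verts G \<union> Inr ` verts H"
    "verts (join G H) = Inl ` verts G \<union> Inr ` verts H" for G :: "'x sgraph" and H :: "'y sgraph"
    by (auto simp: join_def disjoint_union_def)
  have V: "verts ?X = ?S \<union> ?B \<union> ?T \<union> ?I"
    by (simp only: V0 V1 image_Un Un_assoc)
  have mem: "Inl i \<in> ?S \<longleftrightarrow> i < d" "Inr y \<notin> ?S" "Inl i \<notin> ?B" "Inl i \<notin> ?T"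
    "Inr (Inl (Inl i)) \<in> ?B \<longleftrightarrow> i < m" "Inr (Inl (Inr i)) \<notin> ?B" "Inr (Inr z) \<notin> ?B"
    "Inr (Inl (Inr i)) \<in> ?T \<longleftrightarrow> i < t" "Inr (Inl (Inl i)) \<notin> ?T" "Inr (Inr z) \<notin> ?T" for i y z
    by auto
  have vm: "Inl (Inl i) \<in> verts (disjoint_union (disjoint_union (complete_graph m) (complete_graph t)) (copies r (complete_graph 1))) \<longleftrightarrow> i < m"
    "Inl (Inr i) \<in> verts (disjoint_union (disjoint_union (complete_graph m) (complete_graph t)) (copies r (complete_graph 1))) \<longleftrightarrow> i < t"
    "Inr z \<in> verts (disjoint_union (disjoint_union (complete_graph m) (complete_graph t)) (copies r (complete_graph 1))) \<longleftrightarrow> z \<in> {..<r} \<times> {0}" for i z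
    unfolding V0 V1 by auto
  have E: "{u, v} \<in> edges ?X \<longleftrightarrow>
        u \<noteq> v \<and> (u \<in> ?S \<or> v \<in> ?S \<or> u \<in> ?B \<and> v \<in> ?B \<or> u \<in> ?T \<and> v \<in> ?T)"
    if "u \<in> ?S \<union> ?B \<union> ?T \<union> ?I" "v \<in> ?S \<union> ?B \<union> ?T \<union> ?I" for u v
    using that
    by (elim UnE imageE) (simp_all only: edges_join edges_disjoint_union edges_complete_graph E0 mem vm V0
      lessThan_iff sum.inject sum.distinct empty_iff simp_thms)
  show ?thesis unfolding four_blocks_def V
    using E by (intro conjI ballI) auto
qed

lemma extremal_graph_four_blocks:
  "four_blocks (extremal_graph n k d) (Inl ` {..<d}) (Inr ` Inl ` Inl ` {..<n + k - 2 * d - 3})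
     (Inr ` Inl ` Inr ` {..<3}) (Inr ` Inr ` ({..<d - k} \<times> {0}))"
  unfolding extremal_graph_def by (rule join_cliques_four_blocks)

subsection \<open>Barriers of graphs that are not factor-critical\<close>

lemma vertex_degree_eq_card_nbrs:
  assumes "simple_graph G"
  shows "vertex_degree G v = card (nbrs G v)"
proof -
  have "bij_betw (\<lambda>u. {v, u}) (nbrs G v) {e \<in> edges G. v \<in> e}"
    unfolding bij_betw_def
  proof
    show "inj_on (\<lambda>u. {v, u}) (nbrs G v)" by (auto simp: inj_on_def doubleton_eq_iff)
    show "(\<lambda>u. {v, u}) ` nbrs G v = {e \<in> edges G. v \<in> e}"
    proof (intro equalityI subsetI)
      fix e assume e: "e \<in> {e \<in> edges G. v \<in> e}"
      then have "card e = 2" "e \<subseteq> verts G" using assms by (auto simp: simple_graph_def)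
      then obtain u where "e = {v, u}" using e by (auto simp: card_2_iff)
      then show "e \<in> (\<lambda>u. {v, u}) ` nbrs G v"
        using e \<open>e \<subseteq> verts G\<close> by (auto simp: nbrs_def)
    qed (auto simp: nbrs_def)
  qed
  then show ?thesis unfolding vertex_degree_def using bij_betw_same_card by force
qed

lemma min_degree_le_card_nbrs:
  assumes "simple_graph G" "v \<in> verts G"
  shows "min_degree G \<le> card (nbrs G v)"
  unfolding min_degree_def vertex_degree_eq_card_nbrs[OF assms(1), symmetric]
  using assms simple_graphD(1)[OF assms(1)] by (intro Min_le) auto

lemma simple_graph_delete_verts: "simple_graph G \<Longrightarrow> simple_graph (delete_verts G X)"
  by (auto simp: simple_graph_def delete_verts_def)

text \<open>Were the minimum degree below \<open>t\<close>, deleting the neighbours of a vertex of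
  minimum degree would isolate it, although another vertex remains because the order exceeds
  \<open>t\<close>.\<close>

lemma t_connected_le_min_degree:
  assumes G: "simple_graph G" and t: "t_connected t G"
  shows "t \<le> min_degree G"
proof (rule ccontr)
  assume "\<not> t \<le> min_degree G"
  note fin = simple_graphD(1)[OF G]
  have n: "card (verts G) > t" using t by (simp add: t_connected_def graph_order_def)
  then have "verts G \<noteq> {}" by auto
  then have "min_degree G \<in> vertex_degree G ` verts G"
    unfolding min_degree_def using fin by (intro Min_in) auto
  then obtain v where v: "v \<in> verts G" "card (nbrs G v) = min_degree G"
    using vertex_degree_eq_card_nbrs[OF G] by auto
  let ?H = "delete_verts G (nbrs G v)"
  have sub: "nbrs G v \<subseteq> verts G" by (auto simp: nbrs_def)
  have vn: "v \<notin> nbrs G v" using simple_graphD(4)[OF G, of v v] by (auto simp: nbrs_def)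
  have "connected_graph ?H"
    using t sub v(2) \<open>\<not> t \<le> min_degree G\<close> by (simp add: t_connected_def)
  moreover have "v \<in> verts ?H" using v(1) vn by (simp add: delete_verts_def)
  ultimately have "{v} = verts ?H"
  proof (intro connected_graph_closed_set[OF simple_graph_delete_verts[OF G]])
    fix a b assume ab: "a \<in> {v}" "b \<in> verts ?H" "{a, b} \<in> edges ?H"
    then have "b \<in> nbrs G v" by (auto simp: nbrs_def delete_verts_def)
    then show "b \<in> {v}" using ab(2) by (simp add: delete_verts_def)
  qed auto
  then have "card (verts G - nbrs G v) = 1" by (simp add: delete_verts_def card_1_singleton_iff) metis
  moreover have "card (verts G - nbrs G v) = card (verts G) - card (nbrs G v)"
    using sub fin by (intro card_Diff_subset) (auto intro: finite_subset)
  ultimately show False using n v(2) \<open>\<not> t \<le> min_degree G\<close> by linarith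
qed

text \<open>Double counting: the sum of \<open>h e * card (e \<inter> A)\<close> over all edges is
  \<open>card A\<close>, and an edge that meets \<open>I\<close> does so in one vertex and has its
  other end in \<open>T\<close>.\<close>

lemma fractional_perfect_matching_isolated_le:
  assumes H: "simple_graph H" and h: "fractional_perfect_matching H h"
    and I: "I \<subseteq> verts H" and T: "T \<subseteq> verts H" and IT: "\<And>v. v \<in> I \<Longrightarrow> nbrs H v \<subseteq> T" "I \<inter> T = {}"
  shows "card I \<le> card T"
proof -
  note fin = simple_graphD(1,5)[OF H]
  have fI: "finite I" and fT: "finite T" using I T fin finite_subset by blast+
  have count: "real (card A) = (\<Sum>e\<in>edges H. h e * card (e \<inter> A))" if A: "A \<subseteq> verts H" "finite A" for A
  proof -
    have "real (card A) = (\<Sum>v\<in>A. \<Sum>e\<in>{e \<in> edges H. v \<in> e}. h e)"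
    proof -
      have "(\<Sum>e\<in>{e \<in> edges H. v \<in> e}. h e) = 1" if "v \<in> A" for v
        using h A(1) that by (auto simp: fractional_perfect_matching_def)
      then show ?thesis by simp
    qed
    also have "\<dots> = (\<Sum>v\<in>A. \<Sum>e\<in>edges H. if v \<in> e then h e else 0)"
      using fin(2) by (simp add: sum.inter_filter)
    also have "\<dots> = (\<Sum>e\<in>edges H. \<Sum>v\<in>A. if v \<in> e then h e else 0)" by (rule sum.swap)
    also have "\<dots> = (\<Sum>e\<in>edges H. h e * card (e \<inter> A))"
    proof (rule sum.cong)
      fix e
      have "(\<Sum>v\<in>A. if v \<in> e then h e else 0) = (\<Sum>v\<in>{v \<in> A. v \<in> e}. h e)"
        by (rule sum.inter_filter[OF A(2), symmetric])
      also have "{v \<in> A. v \<in> e} = e \<inter> A" by blast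
      finally show "(\<Sum>v\<in>A. if v \<in> e then h e else 0) = h e * card (e \<inter> A)" by simp
    qed simp
    finally show ?thesis .
  qed
  have "card (e \<inter> I) \<le> card (e \<inter> T)" if e: "e \<in> edges H" for e
  proof (cases "e \<inter> I = {}")
    case False
    then obtain v where v: "v \<in> e" "v \<in> I" by blast
    have "card e = 2" "e \<subseteq> verts H" using H e by (auto simp: simple_graph_def)
    then obtain u where u: "e = {v, u}" "u \<noteq> v" using v by (auto simp: card_2_iff)
    then have "u \<in> nbrs H v" using e \<open>e \<subseteq> verts H\<close> by (simp add: nbrs_def)
    then have "u \<in> T" using IT v by blast
    then have "e \<inter> I = {v}" "e \<inter> T = {u}" using u v IT(2) by auto
    then show ?thesis by simp
  qed simp
  then have "(\<Sum>e\<in>edges H. h e * card (e \<inter> I)) \<le> (\<Sum>e\<in>edges H. h e * card (e \<inter> T))"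
    using h by (intro sum_mono mult_left_mono) (auto simp: fractional_perfect_matching_def)
  then show ?thesis using count[OF I fI] count[OF T fT] by simp
qed

lemma odd_barrierD:
  assumes "odd_barrier E U S \<P>"
  shows "S \<subseteq> U" "disjoint \<P>" "P \<in> \<P> \<Longrightarrow> P \<subseteq> U - S" "P \<in> \<P> \<Longrightarrow> odd (card P)" "P \<in> \<P> \<Longrightarrow> P \<noteq> {}"
    "P \<in> \<P> \<Longrightarrow> isolated_in E (U - S) P"
    "P \<in> \<P> \<Longrightarrow> u \<in> P \<Longrightarrow> v \<in> U - S \<Longrightarrow> {u, v} \<in> E \<Longrightarrow> v \<in> P"
  using assms unfolding odd_barrier_def isolated_in_def by (auto dest: bspec)

text \<open>The barrier \<open>T\<close> is found after deleting a set \<open>X\<close> of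
  \<open>k\<close> vertices that leaves no perfect matching, and \<open>X\<close> is then added to
  it. Applying fractional criticality to the same \<open>X\<close> bounds the singleton parts by
  \<open>card T\<close>, that is by \<open>card S - k\<close>.\<close>

lemma not_factor_critical_barrier:
  assumes G: "simple_graph G" and conn: "t_connected (k + 1) G"
    and frac: "fractional_factor_critical k G" and par: "even (card (verts G) - k)"
    and nfc: "\<not> factor_critical k G"
  shows "\<exists>S \<P>. odd_barrier (edges G) (verts G) S \<P> \<and> card S \<ge> k + 1 \<and> card \<P> + k \<ge> card S + 2
    \<and> card {P \<in> \<P>. card P = 1} + k \<le> card S"
proof -
  note fin = simple_graphD(1)[OF G]
  have n: "card (verts G) > k + 1" using conn by (simp add: t_connected_def graph_order_def)
  obtain X where X: "X \<subseteq> verts G" "card X = k"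
    and noM: "\<And>M. \<not> perfect_matching (delete_verts G X) M"
    using nfc n unfolding factor_critical_def graph_order_def by auto
  let ?H = "delete_verts G X"
  have H: "simple_graph ?H" using simple_graph_delete_verts[OF G] .
  have VH: "verts ?H = verts G - X" by (simp add: delete_verts_def)
  have EH: "{u, v} \<in> edges ?H \<longleftrightarrow> {u, v} \<in> edges G \<and> u \<notin> X \<and> v \<notin> X" for u v
    by (auto simp: delete_verts_def)
  have finX: "finite X" using X(1) fin finite_subset by blast
  have fH: "finite (verts ?H)" using fin VH by simp
  have cH: "card (verts ?H) = card (verts G) - k"
    unfolding VH using card_Diff_subset[OF finX X(1)] X(2) by simp
  have evH: "even (card (verts ?H))" using par cH by simp
  have "\<not> (\<forall>T \<P>. odd_barrier (edges ?H) (verts ?H) T \<P> \<longrightarrow> card \<P> \<le> card T)"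
  proof
    assume "\<forall>T \<P>. odd_barrier (edges ?H) (verts ?H) T \<P> \<longrightarrow> card \<P> \<le> card T"
    then have "\<exists>M \<subseteq> edges ?H. (\<forall>e\<in>M. e \<subseteq> verts ?H) \<and> (\<forall>v\<in>verts ?H. \<exists>!e. e \<in> M \<and> v \<in> e)"
      by (intro tutte_matching[OF fH evH]) simp
    then show False using noM unfolding perfect_matching_def by blast
  qed
  then obtain T \<P>0 where "odd_barrier (edges ?H) (verts ?H) T \<P>0" "card \<P>0 > card T"
    by (auto simp: not_le)
  from odd_barrier_parity_gap[OF fH evH this]
  obtain \<P> where \<P>: "odd_barrier (edges ?H) (verts ?H) T \<P>" "card \<P> \<ge> card T + 2" by blast
  note bD = odd_barrierD[OF \<P>(1)]
  have finP: "finite \<P>" using odd_barrier_finite[OF fH \<P>(1)] .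
  have finT: "finite T" using bD(1) fH finite_subset by blast
  have disjXT: "X \<inter> T = {}" using bD(1) VH by blast
  \<comment> \<open>Deleting \<open>k\<close> vertices keeps the graph connected, so for empty
    \<open>T\<close> every part would be the whole vertex set, while there are at least two
    parts.\<close>
  have "T \<noteq> {}"
  proof
    assume T: "T = {}"
    obtain P where P: "P \<in> \<P>" using \<P>(2) by fastforce
    have "\<P> \<noteq> {P}" using \<P>(2) by auto
    then obtain P' where P': "P' \<in> \<P>" "P' \<noteq> P" using P by blast
    have "connected_graph ?H" using conn X unfolding t_connected_def by auto
    then have "Q = verts ?H" if "Q \<in> \<P>" for Q
      using bD(3,5,7)[OF that] T by (intro connected_graph_closed_set[OF H]) auto
    then show False using P P' by metis
  qed
  then have cT: "card T \<ge> 1" using finT by (simp add: Suc_leI card_gt_0_iff)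
  let ?S = "X \<union> T"
  have cS: "card ?S = k + card T" using card_Un_disjoint[OF finX finT disjXT] X(2) by simp
  have W: "verts G - ?S = verts ?H - T" unfolding VH by blast
  have "odd_barrier (edges G) (verts G) ?S \<P>"
    unfolding odd_barrier_def isolated_in_def
  proof (intro conjI ballI impI)
    show "?S \<subseteq> verts G" using X(1) bD(1) VH by auto
    show "disjoint \<P>" by (rule bD(2))
    fix P assume P: "P \<in> \<P>"
    show "odd (card P)" using bD(4)[OF P] .
    show "P \<subseteq> verts G - ?S" using bD(3)[OF P] W by simp
    fix u v assume uv: "u \<in> P" "v \<in> verts G - ?S" "{u, v} \<in> edges G"
    have "u \<notin> X" using bD(3)[OF P] uv(1) VH by auto
    then have "{u, v} \<in> edges ?H" using uv EH by simp
    then show "v \<in> P" using bD(7)[OF P uv(1)] uv(2) W by simp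
  qed
  moreover have "card {P \<in> \<P>. card P = 1} \<le> card T"
  proof -
    obtain h where h: "fractional_perfect_matching ?H h"
      using frac X unfolding fractional_factor_critical_def by blast
    let ?I = "\<Union>{P \<in> \<P>. card P = 1}"
    have fP: "finite P" if "P \<in> \<P>" for P using bD(3)[OF that] fH by (meson finite_Diff finite_subset)
    have "card ?I = (\<Sum>P\<in>{P \<in> \<P>. card P = 1}. card P)"
      using bD(2) fP by (intro card_Union_disjoint) (auto simp: disjoint_def pairwise_def disjnt_def)
    then have cI: "card ?I = card {P \<in> \<P>. card P = 1}" by simp
    have sub: "?I \<subseteq> verts ?H - T" using bD(3) by blast
    have "card ?I \<le> card T"
    proof (rule fractional_perfect_matching_isolated_le[OF H h _ bD(1)])
      fix v assume "v \<in> ?I"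
      then obtain P where P: "P \<in> \<P>" "card P = 1" "v \<in> P" by blast
      then have Pv: "P = {v}" by (auto simp: card_1_singleton_iff)
      have vv: "{v, v} \<notin> edges ?H" using simple_graphD(4)[OF H, of v v] by blast
      show "nbrs ?H v \<subseteq> T"
      proof
        fix w assume w: "w \<in> nbrs ?H v"
        show "w \<in> T"
        proof (rule ccontr)
          assume "w \<notin> T"
          then have "w \<in> P" using bD(7)[OF P(1,3), of w] w by (simp add: nbrs_def)
          then show False using w vv Pv by (simp add: nbrs_def)
        qed
      qed
    qed (use sub in auto)
    then show ?thesis using cI by simp
  qed
  ultimately show ?thesis
    using cS cT \<P>(2) by (intro exI[of _ ?S] exI[of _ \<P>]) auto
qed

text \<open>All neighbours of a vertex of a part lie in \<open>S\<close> or among the other vertices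
  of that part.\<close>

lemma odd_barrier_part_size:
  assumes G: "simple_graph G" and b: "odd_barrier (edges G) (verts G) S \<P>" and P: "P \<in> \<P>"
  shows "min_degree G + 1 \<le> card S + card P"
proof -
  note fin = simple_graphD(1)[OF G] and bD = odd_barrierD[OF b]
  obtain u where u: "u \<in> P" using bD(5)[OF P] by blast
  have PV: "P \<subseteq> verts G - S" using bD(3)[OF P] .
  have f: "finite P" "finite S" using PV bD(1) fin by (meson finite_Diff finite_subset)+
  have "nbrs G u \<subseteq> S \<union> (P - {u})"
    using bD(7)[OF P u] simple_graphD(4)[OF G, of u u] unfolding nbrs_def by blast
  then have "card (nbrs G u) \<le> card (S \<union> (P - {u}))" using f by (intro card_mono) auto
  also have "\<dots> \<le> card S + card (P - {u})" by (rule card_Un_le)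
  also have "card (P - {u}) = card P - 1" using u by simp
  finally have "card (nbrs G u) \<le> card S + (card P - 1)" .
  moreover have "card P \<ge> 1" using u f by (metis One_nat_def Suc_leI card_gt_0_iff empty_iff)
  moreover have "u \<in> verts G" using u PV by blast
  ultimately show ?thesis using min_degree_le_card_nbrs[OF G, of u] by linarith
qed

text \<open>Everything outside \<open>P2\<close> and the \<open>c\<close> chosen parts goes into
  \<open>Q\<close>, including vertices that no part covers. Parity of \<open>Q\<close> is given up,
  but \<open>P1 \<subseteq> Q\<close> hands down a lower bound on its size.\<close>

lemma odd_barrier_merge:
  assumes fin: "finite U" and b: "odd_barrier E U S \<P>" and P: "P1 \<in> \<P>" "P2 \<in> \<P>" "P1 \<noteq> P2"
    and c: "card \<P> \<ge> c + 2"
  obtains Q \<R> where "\<R> \<subseteq> \<P> - {P1, P2}" "card \<R> = c" "P1 \<subseteq> Q" "Q \<notin> insert P2 \<R>"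
    "disjoint (insert Q (insert P2 \<R>))" "\<Union>(insert Q (insert P2 \<R>)) = U - S"
    "\<And>R. R \<in> insert Q (insert P2 \<R>) \<Longrightarrow> isolated_in E (U - S) R"
proof -
  note bD = odd_barrierD[OF b]
  have finP: "finite \<P>" using odd_barrier_finite[OF fin b] .
  have "card (\<P> - {P1, P2}) = card \<P> - 2" using P finP by (simp add: card_Diff_subset)
  then obtain \<R> where R: "\<R> \<subseteq> \<P> - {P1, P2}" "card \<R> = c"
    using c obtain_subset_with_card_n[of c "\<P> - {P1, P2}"] by (metis add_le_imp_le_diff)
  define Q where "Q = U - S - \<Union>(insert P2 \<R>)"
  have P1Q: "P1 \<subseteq> Q"
  proof
    fix v assume v: "v \<in> P1"
    have "v \<notin> R" if "R \<in> \<P>" "R \<noteq> P1" for R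
      using bD(2) P(1) that v unfolding disjoint_def by blast
    then show "v \<in> Q" using v bD(3)[OF P(1)] P R(1) unfolding Q_def by blast
  qed
  have sub: "insert P2 \<R> \<subseteq> \<P>" using R(1) P by blast
  have Qdis: "Q \<inter> R = {}" if "R \<in> insert P2 \<R>" for R using that unfolding Q_def by blast
  have Qne: "Q \<noteq> {}" using P1Q bD(5)[OF P(1)] by blast
  show ?thesis
  proof (rule that[OF R P1Q])
    show "Q \<notin> insert P2 \<R>" using Qdis Qne by blast
    have "disjoint (insert P2 \<R>)" using bD(2) sub by (auto simp: disjoint_def)
    then show "disjoint (insert Q (insert P2 \<R>))"
      using Qdis by (simp add: disjoint_def Int_commute)
    have "\<Union>(insert P2 \<R>) \<subseteq> U - S" using sub bD(3) by blast
    then show "\<Union>(insert Q (insert P2 \<R>)) = U - S" unfolding Q_def by blast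
    have iso: "isolated_in E (U - S) R" if "R \<in> insert P2 \<R>" for R
      using bD(6) sub that by blast
    have "isolated_in E (U - S) Q" unfolding Q_def using iso by (rule isolated_in_rest)
    then show "isolated_in E (U - S) R" if "R \<in> insert Q (insert P2 \<R>)" for R
      using iso that by blast
  qed
qed

subsection \<open>Comparison with the extremal graph\<close>

lemma sum_card_parts:
  assumes "finite U" "S \<subseteq> U" "disjoint \<Q>" "\<Union>\<Q> = U - S"
  shows "(\<Sum>Q\<in>\<Q>. real (card Q)) = real (card U) - real (card S)" and "finite \<Q>"
proof -
  have sub: "Q \<subseteq> U" if "Q \<in> \<Q>" for Q using assms(4) that by blast
  show "finite \<Q>" using sub assms(1) by (intro finite_subset[of \<Q> "Pow U"]) auto
  have "card (\<Union>\<Q>) = (\<Sum>Q\<in>\<Q>. card Q)"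
    using assms(3) finite_subset[OF sub assms(1)]
    by (intro card_Union_disjoint) (auto simp: disjoint_def pairwise_def disjnt_def)
  moreover have "card (U - S) = card U - card S" "card S \<le> card U"
    using assms(1,2) by (auto intro: card_Diff_subset finite_subset card_mono)
  ultimately show "(\<Sum>Q\<in>\<Q>. real (card Q)) = real (card U) - real (card S)"
    using assms(4) by (simp add: of_nat_diff flip: of_nat_sum)
qed

lemma term_le_of_sum:
  fixes b x :: "'i \<Rightarrow> real"
  assumes "finite I" "i \<in> I" "\<And>i. i \<in> I \<Longrightarrow> b i \<le> x i" "b i \<le> \<beta>"
  shows "x i \<le> \<beta> + (\<Sum>i\<in>I. x i - b i)"
proof -
  have "x i - b i \<le> (\<Sum>i\<in>I. x i - b i)"
    using assms(3) by (intro member_le_sum[OF assms(2) _ assms(1)]) simp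
  then show ?thesis using assms(4) by simp
qed

lemma separator_below_contradiction:
  fixes G :: "'a sgraph" and \<theta> m :: real and k d r :: nat
  assumes G: "simple_graph G" "connected_graph G"
    and barrier: "odd_barrier (edges G) (verts G) S \<P>" and k: "k \<ge> 1"
    and d: "min_degree G = d" "d = k + r" and s: "card S \<ge> k + 1" "card S < d"
    and P: "card \<P> + k \<ge> card S + 2"
    and m: "m \<ge> 3" "m = real (card (verts G)) - real d - real r - 3"
    and \<theta>: "m + real d - 1 < \<theta>" "\<theta> \<ge> 3 * real d + 4 * real r + 16"
      "\<theta> \<ge> real d * ((real r - 1)\<^sup>2 - 2) - real r - 5"
    and root: "\<theta> = real d - 1 + d * (m / (\<theta> + 1 - m) + 3 / (\<theta> - 2) + r / \<theta>)"
    and \<rho>: "\<theta> \<le> spectral_radius_graph G"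
  shows False
proof -
  note fin = simple_graphD(1)[OF G(1)] and bD = odd_barrierD[OF barrier]
  define s where "s = card S"
  define j where "j = s - k"
  have j: "s = k + j" "1 \<le> j" "j < r" using s d(2) by (auto simp: j_def s_def)
  \<comment> \<open>The minimum degree gives \<open>r + 1 - j\<close>, which may be as low as 2; odd
    size then raises it to 3.\<close>
  define a where "a = max (r + 1 - j) 3"
  have size: "card P \<ge> a" if "P \<in> \<P>" for P
  proof -
    have "d + 1 \<le> s + card P" using odd_barrier_part_size[OF G(1) barrier that] d(1) by (simp add: s_def)
    then have "r + 1 - j \<le> card P" "card P \<ge> 2" using j d(2) by auto
    moreover have "card P \<noteq> 2" using bD(4)[OF that] by auto
    ultimately show ?thesis unfolding a_def by simp
  qed
  have "card \<P> \<ge> 2" using P s by simp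
  then obtain P1 where P1: "P1 \<in> \<P>" by fastforce
  have "\<P> \<noteq> {P1}" using \<open>card \<P> \<ge> 2\<close> by auto
  then obtain P2 where P2: "P2 \<in> \<P>" "P1 \<noteq> P2" using P1 by blast
  have "card \<P> \<ge> j + 2" using P j(1) by (simp add: s_def)
  from odd_barrier_merge[OF fin barrier P1 P2 this]
  obtain Q \<R> where R: "\<R> \<subseteq> \<P> - {P1, P2}" "card \<R> = j" "P1 \<subseteq> Q" "Q \<notin> insert P2 \<R>"
    "disjoint (insert Q (insert P2 \<R>))" "\<Union>(insert Q (insert P2 \<R>)) = verts G - S"
    "\<And>R. R \<in> insert Q (insert P2 \<R>) \<Longrightarrow> isolated_in (edges G) (verts G - S) R" by blast
  define \<Q> where "\<Q> = insert Q (insert P2 \<R>)"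
  note RQ = R(5-7)[folded \<Q>_def]
  note sums = sum_card_parts[OF fin bD(1) RQ(1,2)]
  have finR: "finite \<R>" using sums(2) by (simp add: \<Q>_def)
  have "P2 \<notin> \<R>" using R(1) by blast
  then have cQ: "card \<Q> = j + 2" using R(2,4) finR by (simp add: \<Q>_def)
  have sizeQ: "real a \<le> real (card X)" if X: "X \<in> \<Q>" for X
  proof -
    have "Q \<subseteq> verts G" using R(6) by blast
    then have "finite Q" using fin by (rule finite_subset)
    then have "card P1 \<le> card Q" using R(3) by (rule card_mono)
    then have "a \<le> card Q" using size[OF P1] by simp
    then show ?thesis using X size P2(1) R(1) by (auto simp: \<Q>_def)
  qed
  \<comment> \<open>With all \<open>j + 2\<close> parts starting at size \<open>a\<close>, this is
    the size of one that takes the whole surplus, and hence also an upper bound for every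
    part.\<close>
  define M where "M = m + real d + real r + 3 - real s - real (j + 1) * real a"
  have ex: "(\<Sum>X\<in>\<Q>. real (card X) - real a) = M - a"
    using sums(1) cQ m(2) by (simp add: sum_subtractf M_def s_def algebra_simps)
  have "(\<Sum>X\<in>\<Q>. real (card X) - real a) \<ge> 0" using sizeQ by (intro sum_nonneg) simp
  then have aM: "real a \<le> M" using ex by simp
  note below = separator_below_min_degree[OF k j(1) d(2) j(2,3) a_def m(1) \<theta> root M_def]
  define N where "N = \<theta> + 1"
  have N: "0 < N" "real a < N" "M < N" using below(1) aM by (auto simp: N_def)
  have leM: "real (card X) \<le> M" if "X \<in> \<Q>" for X
    using term_le_of_sum[OF sums(2) that, of "\<lambda>_. real a" "\<lambda>X. real (card X)" a] sizeQ ex by simp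
  have "(\<Sum>X\<in>\<Q>. card X / (N - card X)) \<le> (\<Sum>X\<in>\<Q>. real a / (N - a)) + (M - a) * (N / ((N - a) * (N - M)))"
    using sum_frac_le(1)[OF sums(2) N, of "\<lambda>_. real a" "\<lambda>X. real (card X)"] sizeQ leM ex by simp
  also have "(\<Sum>X\<in>\<Q>. real a / (N - a)) = real (j + 1) * (a / (N - a)) + a / (N - a)"
  proof -
    have "(\<Sum>X\<in>\<Q>. z) = real (j + 1) * z + z" for z :: real
      using cQ by (simp add: algebra_simps)
    then show ?thesis .
  qed
  also have "real (j + 1) * (a / (N - a)) + a / (N - a) + (M - a) * (N / ((N - a) * (N - M)))
      = M / (N - M) + (real (j + 1) * a) / (N - a)"
    using frac_merge[OF N(2,3)] by simp
  finally have "s * (\<Sum>X\<in>\<Q>. card X / (N - card X)) \<le> s * (M / (N - M) + (real (j + 1) * a) / (N - a))"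
    by (intro mult_left_mono) auto
  then have lt: "real s - 1 + s * (\<Sum>X\<in>\<Q>. card X / (\<theta> + 1 - card X)) < \<theta>"
    using below(2) by (simp add: N_def)
  have "real s - 1 + s * (\<Sum>X\<in>\<Q>. card X / (\<theta> + 1 - card X)) = \<theta>"
    unfolding s_def
  proof (rule clique_join_bound_tight(1)[OF G bD(1) _ RQ(1,2)])
    show "S \<noteq> {}" using s by auto
    show "v \<in> X" if "X \<in> \<Q>" "u \<in> X" "v \<in> verts G - S" "{u, v} \<in> edges G" for X u v
      using RQ(3)[OF that(1)] that unfolding isolated_in_def by blast
    show "0 < \<theta>" using \<theta>(2) by simp
    show "real (card X) < \<theta> + 1" if "X \<in> \<Q>" for X using leM[OF that] below(1) by simp
    show "real (card S) - 1 + card S * (\<Sum>X\<in>\<Q>. card X / (\<theta> + 1 - card X)) \<le> \<theta>"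
      using lt by (simp add: s_def)
  qed (rule \<rho>)
  then show False using lt by simp
qed

lemma separator_at_least_min_degree:
  fixes G :: "'a sgraph" and \<theta> m :: real and k d r :: nat
  assumes G: "simple_graph G" "connected_graph G"
    and barrier: "odd_barrier (edges G) (verts G) S \<P>"
    and d: "d = k + r" "d \<ge> 1" and s: "card S \<ge> k + 1" "card S \<ge> d"
    and P: "card \<P> + k \<ge> card S + 2" "card {P \<in> \<P>. card P = 1} + k \<le> card S"
    and m: "m \<ge> 3" "m = real (card (verts G)) - real d - real r - 3"
    and \<theta>: "m + real d - 1 < \<theta>" "\<theta> \<ge> 3 * real d + 4 * real r + 16"
    and root: "\<theta> = real d - 1 + d * (m / (\<theta> + 1 - m) + 3 / (\<theta> - 2) + r / \<theta>)"
    and \<rho>: "\<theta> \<le> spectral_radius_graph G"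
  shows "\<exists>B T I. four_blocks G S B T I \<and> card S = d \<and> real (card B) = m \<and> card T = 3 \<and> card I = r"
proof -
  note fin = simple_graphD(1)[OF G(1)] and bD = odd_barrierD[OF barrier]
  have finP: "finite \<P>" using odd_barrier_finite[OF fin barrier] .
  define s where "s = card S"
  define j where "j = s - k"
  have j: "s = k + j" using s by (simp add: j_def s_def)
  have big: "card P \<ge> 3" if "P \<in> \<P>" "card P \<noteq> 1" for P
  proof -
    have "odd (card P)" using bD(4)[OF that(1)] .
    then have "card P \<noteq> 0" "card P \<noteq> 2" by (metis even_zero, auto)
    then show ?thesis using that(2) by simp
  qed
  have "card {P \<in> \<P>. card P \<noteq> 1} + card {P \<in> \<P>. card P = 1} = card \<P>"
  proof -
    have "\<P> = {P \<in> \<P>. card P \<noteq> 1} \<union> {P \<in> \<P>. card P = 1}" by blast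
    then show ?thesis
      using card_Un_disjoint[of "{P \<in> \<P>. card P \<noteq> 1}" "{P \<in> \<P>. card P = 1}"] finP by fastforce
  qed
  \<comment> \<open>At least \<open>s - k + 2\<close> parts contain at most \<open>s - k\<close>
    singletons. Two parts are thus odd and larger than 1, so they have at least three vertices: the
    origin of the triangle in the extremal graph.\<close>
  then have "card {P \<in> \<P>. card P \<noteq> 1} \<ge> 2" using P by simp
  moreover define \<N> where "\<N> = {P \<in> \<P>. card P \<noteq> 1}"
  ultimately have two: "card \<N> \<ge> 2" by simp
  then obtain P1 where P1: "P1 \<in> \<N>" by fastforce
  have "\<N> \<noteq> {P1}" using two by auto
  then obtain P2 where P2: "P2 \<in> \<N>" "P1 \<noteq> P2" using P1 by blast
  have P12: "P1 \<in> \<P>" "P2 \<in> \<P>" "card P1 \<ge> 3" "card P2 \<ge> 3" using P1 P2 big by (auto simp: \<N>_def)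
  have "card \<P> \<ge> j + 2" using P(1) j(1) by (simp add: s_def)
  from odd_barrier_merge[OF fin barrier P12(1,2) P2(2) this]
  obtain Q \<R> where R: "\<R> \<subseteq> \<P> - {P1, P2}" "card \<R> = j" "P1 \<subseteq> Q" "Q \<notin> insert P2 \<R>"
    "disjoint (insert Q (insert P2 \<R>))" "\<Union>(insert Q (insert P2 \<R>)) = verts G - S"
    "\<And>R. R \<in> insert Q (insert P2 \<R>) \<Longrightarrow> isolated_in (edges G) (verts G - S) R" by blast
  define \<Q> where "\<Q> = insert Q (insert P2 \<R>)"
  note RQ = R(5-7)[folded \<Q>_def]
  note sums = sum_card_parts[OF fin bD(1) RQ(1,2)]
  have finR: "finite \<R>" using sums(2) by (simp add: \<Q>_def)
  have nR: "P2 \<notin> \<R>" "Q \<noteq> P2" "Q \<notin> \<R>" using R(1,4) by auto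
  have sumQ: "(\<Sum>X\<in>\<Q>. f X) = f Q + f P2 + (\<Sum>X\<in>\<R>. f X)" for f :: "'a set \<Rightarrow> real"
    using finR nR by (simp add: \<Q>_def)
  \<comment> \<open>Base sizes: 3 for \<open>P2\<close> and for \<open>Q\<close>, which contains
    \<open>P1\<close>, and 1 for the other \<open>j\<close> parts.\<close>
  define b :: "'a set \<Rightarrow> real" where "b X = (if X \<in> \<R> then 1 else 3)" for X
  have bv: "b Q = 3" "b P2 = 3" "\<And>X. X \<in> \<R> \<Longrightarrow> b X = 1" using nR by (auto simp: b_def)
  have finQ: "finite X" if "X \<in> \<Q>" for X
  proof -
    have "X \<subseteq> verts G" using RQ(2) that by blast
    then show ?thesis using fin by (rule finite_subset)
  qed
  have sizeQ: "b X \<le> real (card X)" if X: "X \<in> \<Q>" for X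
  proof (cases "X \<in> \<R>")
    case True
    then have "X \<noteq> {}" using R(1) bD(5) by blast
    then have "card X \<ge> 1" using finQ[OF X] by (simp add: Suc_leI card_gt_0_iff)
    then show ?thesis using bv(3)[OF True] by simp
  next
    case False
    have "card P1 \<le> card Q" using R(3) finQ[of Q] by (intro card_mono) (auto simp: \<Q>_def)
    then have "card X \<ge> 3" using False X P12 by (auto simp: \<Q>_def)
    then show ?thesis using False by (simp add: b_def)
  qed
  define t where "t = real s - real d"
  define M where "M = m - 2 * t"
  have rt: "real j = r + t" using j d by (simp add: t_def)
  have sumb: "(\<Sum>X\<in>\<Q>. b X) = 6 + real j" unfolding sumQ using bv R(2) by simp
  have ex: "(\<Sum>X\<in>\<Q>. real (card X) - b X) = M - 3"
    using sums(1) sumb m(2) rt by (simp add: sum_subtractf M_def t_def s_def)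
  have "(\<Sum>X\<in>\<Q>. real (card X) - b X) \<ge> 0" using sizeQ by (intro sum_nonneg) simp
  then have M3: "3 \<le> M" using ex by simp
  have t0: "t \<ge> 0" using s by (simp add: t_def s_def)
  define N where "N = \<theta> + 1"
  have MN: "M < \<theta> + 1" using \<theta>(1) t0 d(2) by (simp add: M_def)
  have N: "0 < N" "3 < N" "M < N" using MN M3 by (auto simp: N_def)
  have leM: "real (card X) \<le> M" if "X \<in> \<Q>" for X
    using term_le_of_sum[OF sums(2) that, of b "\<lambda>X. real (card X)" 3] sizeQ ex by (simp add: b_def)
  have b3: "b X \<le> 3" for X by (simp add: b_def)
  define L where "L = (\<Sum>X\<in>\<Q>. card X / (N - card X))"
  define R' where "R' = M / (N - M) + 3 / (\<theta> - 2) + (r + t) / \<theta>"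
  have R': "(\<Sum>X\<in>\<Q>. b X / (N - b X)) + (\<Sum>X\<in>\<Q>. real (card X) - b X) * (N / ((N - 3) * (N - M))) = R'"
  proof -
    have "(\<Sum>X\<in>\<R>. b X / (N - b X)) = (r + t) / \<theta>" using bv(3) R(2) rt by (simp add: N_def)
    moreover have "3 / (N - 3) = 3 / (\<theta> - 2)" by (simp add: N_def)
    ultimately show ?thesis
      unfolding sumQ[of "\<lambda>X. b X / (N - b X)"] ex R'_def bv(1,2) using frac_merge[OF N(2,3)] by linarith
  qed
  have L: "L \<le> R'"
    unfolding L_def R'[symmetric] using sums(2) N sizeQ b3 leM by (rule sum_frac_le(1))
  have R'b: "real s - 1 + s * R' \<le> \<theta>" "t > 0 \<Longrightarrow> real s - 1 + s * R' < \<theta>"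
    "t = 0 \<Longrightarrow> real s - 1 + s * R' = \<theta>"
  proof -
    have st: "real s = real d + t" by (simp add: t_def)
    show lt: "real s - 1 + s * R' < \<theta>" if "t > 0"
      using separator_above_min_degree[OF _ m(1) _ \<theta> root that] M3 d(2)
      unfolding R'_def st N_def M_def by simp
    show eq: "real s - 1 + s * R' = \<theta>" if "t = 0"
      using root that unfolding R'_def st N_def M_def by simp
    show "real s - 1 + s * R' \<le> \<theta>" using lt eq t0 by fastforce
  qed
  have "s * L \<le> s * R'" using L by (intro mult_left_mono) auto
  then have bound: "real (card S) - 1 + card S * (\<Sum>X\<in>\<Q>. card X / (\<theta> + 1 - card X)) \<le> \<theta>"
    using R'b(1) by (simp add: L_def N_def s_def)
  have Sne: "S \<noteq> {}" using s by auto
  have iso: "v \<in> X" if "X \<in> \<Q>" "u \<in> X" "v \<in> verts G - S" "{u, v} \<in> edges G" for X u v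
    using RQ(3)[OF that(1)] that unfolding isolated_in_def by blast
  have \<theta>0: "0 < \<theta>" using \<theta>(2) by simp
  have lt\<theta>: "real (card X) < \<theta> + 1" if "X \<in> \<Q>" for X using leM[OF that] MN by simp
  have "real (card S) - 1 + card S * (\<Sum>X\<in>\<Q>. card X / (\<theta> + 1 - card X)) = \<theta>"
    using G bD(1) Sne RQ(1,2) iso \<theta>0 lt\<theta> bound \<rho> by (rule clique_join_bound_tight(1))
  then have eqL: "real s - 1 + s * L = \<theta>" by (simp add: L_def N_def s_def)
  have joinS: "{u, v} \<in> edges G" if "u \<in> S" "v \<in> verts G" "u \<noteq> v" for u v
    using G bD(1) Sne RQ(1,2) iso \<theta>0 lt\<theta> bound \<rho> that by (rule clique_join_bound_tight(2))
  have clique: "{u, v} \<in> edges G" if "X \<in> \<Q>" "u \<in> X" "v \<in> X" "u \<noteq> v" for X u v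
    using G bD(1) Sne RQ(1,2) iso \<theta>0 lt\<theta> bound \<rho> that by (rule clique_join_bound_tight(3))
  \<comment> \<open>The spectral hypothesis forces \<open>s - 1 + s * L = \<theta>\<close>, whereas
    the bound is strict for \<open>t > 0\<close>.\<close>
  have "\<not> t > 0" using R'b(2) eqL \<open>s * L \<le> s * R'\<close> by fastforce
  then have t: "t = 0" using t0 by simp
  have s0: "real s > 0" using s by (simp add: s_def)
  have "s * L = s * R'" using R'b(3)[OF t] eqL by linarith
  then have LR: "L = R'" using s0 by simp
  have sd: "card S = d" using t by (simp add: t_def s_def)
  have Mm: "M = m" using t by (simp add: M_def)
  have eqs: "real (card X) = b X \<or> b X = 3 \<and> real (card X) = M" if "X \<in> \<Q>" for X
    using sums(2) N sizeQ b3 leM LR[unfolded L_def R'[symmetric]] that by (rule sum_frac_le(2))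
  have single: "card X = 1" if "X \<in> \<R>" for X
    using eqs[of X] bv(3)[OF that] that by (auto simp: \<Q>_def)
  have sumR: "(\<Sum>X\<in>\<R>. real (card X)) = r" using single R(2) rt t by simp
  have tot: "real (card Q) + real (card P2) = m + 3"
    using ex sumb unfolding sum_subtractf sumQ[of "\<lambda>X. real (card X)"] sumR Mm using rt t by simp
  \<comment> \<open>The equality case does not tell which of \<open>Q\<close> and \<open>P2\<close>
    took the surplus; the total \<open>m + 3\<close> determines the other one.\<close>
  have "card Q = 3 \<or> real (card Q) = m" using eqs[of Q] bv(1) Mm by (auto simp: \<Q>_def)
  then obtain B T where BT: "B \<in> \<Q>" "T \<in> \<Q>" "\<Q> = insert B (insert T \<R>)" "B \<noteq> T" "B \<notin> \<R>" "T \<notin> \<R>"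
    "card T = 3" "real (card B) = m"
  proof
    assume c: "card Q = 3"
    show ?thesis by (rule that[of P2 Q]) (use c tot nR in \<open>auto simp: \<Q>_def\<close>)
  next
    assume c: "real (card Q) = m"
    show ?thesis by (rule that[of Q P2]) (use c tot nR in \<open>auto simp: \<Q>_def\<close>)
  qed
  let ?I = "\<Union>\<R>"
  have dj: "X \<inter> Y = {}" if "X \<in> \<Q>" "Y \<in> \<Q>" "X \<noteq> Y" for X Y using RQ(1) that by (simp add: disjoint_def)
  have RQsub: "\<R> \<subseteq> \<Q>" by (auto simp: \<Q>_def)
  have SQ: "S \<inter> X = {}" if "X \<in> \<Q>" for X using RQ(2) that by blast
  have V: "verts G = S \<union> B \<union> T \<union> ?I" using RQ(2) bD(1) unfolding BT(3) by auto
  have cI: "card ?I = r"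
  proof -
    have "card ?I = (\<Sum>X\<in>\<R>. card X)"
      using RQ(1) RQsub finQ by (intro card_Union_disjoint) (auto simp: disjoint_def pairwise_def disjnt_def)
    then show ?thesis using sumR by (simp flip: of_nat_sum)
  qed
  have inI: "X = {v}" if "v \<in> X" "X \<in> \<R>" for X v
    using single[OF that(2)] that(1) by (auto simp: card_1_singleton_iff)
  have noloop: "{v, v} \<notin> edges G" for v using simple_graphD(4)[OF G(1), of v v] by blast
  have ed: "{u, v} \<in> edges G \<longleftrightarrow> u \<noteq> v \<and> (u \<in> S \<or> v \<in> S \<or> u \<in> B \<and> v \<in> B \<or> u \<in> T \<and> v \<in> T)"
    if uv: "u \<in> verts G" "v \<in> verts G" for u v
  proof
    assume e: "{u, v} \<in> edges G"
    have ne: "u \<noteq> v" using e noloop by auto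
    have "u \<in> B \<and> v \<in> B \<or> u \<in> T \<and> v \<in> T" if out: "u \<notin> S" "v \<notin> S"
    proof -
      have "u \<in> verts G - S" using uv out by simp
      then obtain X where X: "X \<in> \<Q>" "u \<in> X" using RQ(2) by blast
      then have vX: "v \<in> X" using iso[OF X, of v] uv out e by simp
      have "X \<notin> \<R>" using inI[OF X(2)] inI[OF vX] ne by auto
      then show ?thesis using X vX BT(3) by auto
    qed
    then show "u \<noteq> v \<and> (u \<in> S \<or> v \<in> S \<or> u \<in> B \<and> v \<in> B \<or> u \<in> T \<and> v \<in> T)" using ne by blast
  next
    assume a: "u \<noteq> v \<and> (u \<in> S \<or> v \<in> S \<or> u \<in> B \<and> v \<in> B \<or> u \<in> T \<and> v \<in> T)"
    have "{v, u} = {u, v}" by (rule insert_commute)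
    then show "{u, v} \<in> edges G"
      using a joinS[of u v] joinS[of v u] clique[OF BT(1), of u v] clique[OF BT(2), of u v] uv by auto
  qed
  have dis: "S \<inter> B = {}" "S \<inter> T = {}" "B \<inter> T = {}" using SQ BT(1,2,4) dj by auto
  have dis': "S \<inter> ?I = {}" "B \<inter> ?I = {}" "T \<inter> ?I = {}"
  proof -
    have "S \<inter> X = {} \<and> B \<inter> X = {} \<and> T \<inter> X = {}" if "X \<in> \<R>" for X
      using SQ[of X] dj[OF BT(1), of X] dj[OF BT(2), of X] that RQsub BT(5,6) by blast
    then show "S \<inter> ?I = {}" "B \<inter> ?I = {}" "T \<inter> ?I = {}" by blast+
  qed
  have "four_blocks G S B T ?I"
    unfolding four_blocks_def using fin V dis dis' ed by simp
  then show ?thesis using sd BT(7,8) cI by blast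
qed

theorem theorem1p4:
  fixes G :: "'a sgraph" and k n \<delta> :: nat
  assumes "k \<ge> 1"
    and "simple_graph G"
    and "graph_order G = n"
    and "min_degree G = \<delta>"
    and "t_connected (k + 1) G"
    and "fractional_factor_critical k G"
    and "[n = k] (mod 2)"
    and "int n \<ge> max (8 * int \<delta> - 5 * int k + 20)
                     (int \<delta> * (int \<delta> - int k - 1)\<^sup>2 - 2 * int \<delta> - 1)"
    and "spectral_radius_graph G \<ge> spectral_radius_graph (extremal_graph n k \<delta>)"
  shows "factor_critical k G \<or> graph_iso G (extremal_graph n k \<delta>)"
proof (rule disjCI)
  assume noiso: "\<not> graph_iso G (extremal_graph n k \<delta>)"
  show "factor_critical k G"
  proof (rule ccontr)
    assume nfc: "\<not> factor_critical k G"
    note G = assms(2)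
    have n: "card (verts G) = n" "n > k + 1" using assms(3,5) by (auto simp: t_connected_def graph_order_def)
    have "k + 1 \<le> \<delta>" using t_connected_le_min_degree[OF G assms(5)] assms(4) by simp
    then obtain r where r: "\<delta> = k + r" "r \<ge> 1" by (metis add.assoc le_Suc_ex le_add1)
    have conn: "connected_graph G"
    proof -
      have "connected_graph (delete_verts G {})" using assms(5) unfolding t_connected_def by auto
      moreover have "delete_verts G {} = G" by (simp add: delete_verts_def)
      ultimately show ?thesis by simp
    qed
    have "even (card (verts G) - k)"
      using assms(7) n by (simp add: cong_def) presburger
    from not_factor_critical_barrier[OF G assms(5,6) this nfc]
    obtain S \<P> where b: "odd_barrier (edges G) (verts G) S \<P>" and S: "card S \<ge> k + 1"
      and P: "card \<P> + k \<ge> card S + 2" "card {P \<in> \<P>. card P = 1} + k \<le> card S" by blast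
    have b1: "int n \<ge> 8 * int \<delta> - 5 * int k + 20"
      and b2: "int n \<ge> int \<delta> * (int \<delta> - int k - 1)\<^sup>2 - 2 * int \<delta> - 1" using assms(8) by auto
    have n1: "real n \<ge> 3 * real \<delta> + 5 * real r + 20" using b1 r by linarith
    have n2: "real n \<ge> real \<delta> * (real r - 1)\<^sup>2 - 2 * real \<delta> - 1"
    proof -
      have "real_of_int (int n) \<ge> real_of_int (int \<delta> * (int \<delta> - int k - 1)\<^sup>2 - 2 * int \<delta> - 1)"
        using b2 by (simp only: of_int_le_iff)
      then show ?thesis using r(1) by simp
    qed
    define m where "m = n + k - 2 * \<delta> - 3"
    have m: "real m = real n - real \<delta> - real r - 3"
    proof -
      have "2 * \<delta> + 3 \<le> n + k" using b1 r by linarith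
      then show ?thesis using r(1) by (simp add: m_def of_nat_diff)
    qed
    have d1: "real \<delta> \<ge> 1" "\<delta> \<ge> 1" using assms(1) r by auto
    have m3: "real m \<ge> 3" using m n1 d1 by simp
    obtain \<theta> :: real where \<theta>: "m + real \<delta> - 1 < \<theta>"
      and root: "\<theta> = real \<delta> - 1 + \<delta> * (m / (\<theta> + 1 - m) + 3 / (\<theta> - 2) + r / \<theta>)"
      using extremal_root_exists[OF d1(1) m3, of r] by auto
    \<comment> \<open>Since \<open>m + \<delta> - 1 = n - r - 4\<close>, each lower bound on
      \<open>n\<close> becomes one on \<open>\<theta>\<close>; in the linear one
      \<open>8 \<delta> - 5 k\<close> is \<open>3 \<delta> + 5 r\<close>.\<close>
    have \<theta>1: "\<theta> \<ge> 3 * real \<delta> + 4 * real r + 16" using \<theta> n1 m by simp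
    have \<theta>2: "\<theta> \<ge> real \<delta> * ((real r - 1)\<^sup>2 - 2) - real r - 5"
      using \<theta> n2 m by (simp add: right_diff_distrib)
    note X = extremal_graph_four_blocks[of n k \<delta>, folded m_def]
    let ?S = "Inl ` {..<\<delta>} :: (nat + (nat + nat) + nat \<times> nat) set"
    let ?B = "Inr ` Inl ` Inl ` {..<m} :: (nat + (nat + nat) + nat \<times> nat) set"
    let ?T = "Inr ` Inl ` Inr ` {..<3} :: (nat + (nat + nat) + nat \<times> nat) set"
    let ?I = "Inr ` Inr ` ({..<\<delta> - k} \<times> {0}) :: (nat + (nat + nat) + nat \<times> nat) set"
    have cX: "card ?S = \<delta>" "card ?B = m" "card ?T = 3" "card ?I = r"
      using r(1) by (simp_all add: card_image card_cartesian_product)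
    have Sne: "?S \<noteq> {}" using d1 by (auto simp: lessThan_empty_iff)
    have "eigenvalue (adj_matrix (extremal_graph n k \<delta>)) \<theta>"
    proof (rule four_blocks_eigenvalue[OF X cX(3) Sne])
      show "real (card ?B) - 1 < \<theta>" using \<theta> cX by simp
      show "2 < \<theta>" using \<theta>1 by simp
      show "\<theta> = real (card ?S) - 1 + card ?S * (card ?B / (\<theta> + 1 - card ?B) + 3 / (\<theta> - 2) + card ?I / \<theta>)"
        unfolding cX by (rule root)
    qed
    moreover have "finite (verts (extremal_graph n k \<delta>))" "?S \<subseteq> verts (extremal_graph n k \<delta>)"
      using four_blocks_verts[OF X] by blast+
    moreover from this have "verts (extremal_graph n k \<delta>) \<noteq> {}" using Sne by (metis subset_empty)
    ultimately have "\<theta> \<le> spectral_radius_graph (extremal_graph n k \<delta>)"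
      using spectral_radius_graph(2) by blast
    then have \<rho>: "\<theta> \<le> spectral_radius_graph G" using assms(9) by simp
    show False
    proof (cases "card S < \<delta>")
      case True
      show False
        by (rule separator_below_contradiction[OF G conn b assms(1,4) r(1) S True P(1) m3 _ \<theta> \<theta>1 \<theta>2 root \<rho>])
          (simp add: m n)
    next
      case False
      then have "\<exists>B T I. four_blocks G S B T I \<and> card S = \<delta> \<and> real (card B) = real m \<and> card T = 3 \<and> card I = r"
        by (intro separator_at_least_min_degree[OF G conn b r(1) d1(2) S _ P m3 _ \<theta> \<theta>1 root \<rho>])
          (simp_all add: m n)
      then obtain B T I where "four_blocks G S B T I" "card S = \<delta>" "card B = m" "card T = 3" "card I = r"
        by auto
      then have "graph_iso G (extremal_graph n k \<delta>)"
        using four_blocks_iso[OF _ X] cX by simp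
      then show False using noiso by simp
    qed
  qed
qed

end
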